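(* Let $A\in\mathbb{C}^{n\times n}$ and $1\le k\le n$. The convex cone $\widehat{\Lambda_k(A)}\subseteq\mathbb{R}^3$ has the inequality description $$\widehat{\Lambda_k(A)}=\{(c,a,b)\in\mathbb{R}^3 : c\ge 0 \text{ and } \cos(\theta)a+\sin(\theta)b\le \lambda_k(\theta)c \text{ for all }\theta\in[0,2\pi)\},$$ and its dual cone is $$(\widehat{\Lambda_k(A)})^{*}=\overline{\operatorname{conicalHull}\big(\{(1,0,0)\}\cup O_k(A)\big)},$$ where the bar denotes Euclidean closure.
   Context: For $A\in\mathbb{C}^{n\times n}$ put $\Re(A)=\frac12(A+A^* )$ and $\Im(A)=\frac{1}{2i}(A-A^* )$, both Hermitian. For a Hermitian $n\times n$ matrix $M$, $\lambda_1(M)\ge\dots\ge\lambda_n(M)$ are its eigenvalues with multiplicity, and $\lambda_k(\theta)=\lambda_k(\cos(\theta)\Re(A)+\sin(\theta)\Im(A))$. The rank-$k$ numerical range is $\Lambda_k(A)=\{\mu\in\mathbb{C}: \exists X\in\mathbb{C}^{n\times k} \text{ with } X^*X=I_k,\ X^*AX=\mu I_k\}$. When $\Lambda_k(A)\neq\emptyset$, $\widehat{\Lambda_k(A)}=\{(\lambda,\lambda a,\lambda b): a+ib\in\Lambda_k(A),\ a,b\in\mathbb{R},\ \lambda\in\mathbb{R}_{\ge0}\}$; when $\Lambda_k(A)=\emptyset$, $\widehat{\Lambda_k(A)}=\{(0,0,0)\}$ by convention. Further, $O_k(A)=\{(\lambda_k(\theta),-\cos\theta,-\sin\theta):\theta\in[0,2\pi)\}\subset\mathbb{R}^3$.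 For a set $S$, $\operatorname{conicalHull}(S)$ is the set of all finite nonnegative linear combinations of elements of $S$. For a convex cone $C\subseteq\mathbb{R}^3$, $C^*=\{w\in\mathbb{R}^3:\langle w,v\rangle\ge0\text{ for all }v\in C\}$. *)

theory Defs
  imports
    "HOL-Analysis.Analysis"
    "Jordan_Normal_Form.Schur_Decomposition"
begin

text \<open>
  A complex n-by-n matrix is an element of \<open>carrier_mat n n\<close>, and Euclidean 3-space is
  \<open>real \<times> real \<times> real\<close>, whose inner product and topology are the standard ones.
\<close>

definition mat_Re :: "complex mat \<Rightarrow> complex mat" where
  "mat_Re A = (1 / 2) \<cdot>\<^sub>m (A + mat_adjoint A)"

definition mat_Im :: "complex mat \<Rightarrow> complex mat" where
  "mat_Im A = (1 / (2 * \<i>)) \<cdot>\<^sub>m (A - mat_adjoint A)"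

text \<open>
  The \<open>k\<close>-th largest eigenvalue, counted from \<open>k = 1\<close> and with algebraic multiplicity. This is
  meant for Hermitian \<open>M\<close> and \<open>1 \<le> k \<le> dim_row M\<close>; the eigenvalues are then real, so that
  \<open>Re\<close> only changes their type.
\<close>

definition herm_eigval :: "nat \<Rightarrow> complex mat \<Rightarrow> real" where
  "herm_eigval k M =
     rev (sorted_list_of_multiset (image_mset Re (proots (char_poly M)))) ! (k - 1)"

definition eigval_angle :: "nat \<Rightarrow> complex mat \<Rightarrow> real \<Rightarrow> real" where
  "eigval_angle k A \<theta> =
     herm_eigval k (complex_of_real (cos \<theta>) \<cdot>\<^sub>m mat_Re A + complex_of_real (sin \<theta>) \<cdot>\<^sub>m mat_Im A)"

definition rank_numerical_range :: "nat \<Rightarrow> complex mat \<Rightarrow> complex set" where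
  "rank_numerical_range k A =
     {\<mu>. \<exists>X \<in> carrier_mat (dim_row A) k.
           mat_adjoint X * X = 1\<^sub>m k \<and> mat_adjoint X * A * X = \<mu> \<cdot>\<^sub>m 1\<^sub>m k}"

definition numerical_range_cone :: "nat \<Rightarrow> complex mat \<Rightarrow> (real \<times> real \<times> real) set" where
  "numerical_range_cone k A =
     (if rank_numerical_range k A = {} then {(0, 0, 0)}
      else {(l, l * a, l * b) | l a b. Complex a b \<in> rank_numerical_range k A \<and> 0 \<le> l})"

definition eigval_curve :: "nat \<Rightarrow> complex mat \<Rightarrow> (real \<times> real \<times> real) set" where
  "eigval_curve k A = {(eigval_angle k A \<theta>, - cos \<theta>, - sin \<theta>) | \<theta>. \<theta> \<in> {0..<2 * pi}}"

definition conical_hull :: "'a::real_vector set \<Rightarrow> 'a set" where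
  "conical_hull S =
     {(\<Sum>x\<in>F. c x *\<^sub>R x) | F c. finite F \<and> F \<subseteq> S \<and> (\<forall>x\<in>F. 0 \<le> c x)}"

definition dual_cone :: "'a::real_inner set \<Rightarrow> 'a set" where
  "dual_cone C = {w. \<forall>v\<in>C. 0 \<le> inner w v}"

end

theory Submission
  imports
    Defs
    "Jordan_Normal_Form.Spectral_Radius"
    "HOL-Library.Function_Algebras"
begin

unbundle no vec_syntax

text \<open>
  The inequality description is the Li--Sze theorem: if no Hermitian form of the pencil spanned by
  the Hermitian forms \<open>g\<close>, \<open>h\<close> on an \<open>n\<close>-dimensional space has negative index above \<open>d\<close>, then \<open>g\<close>
  and \<open>h\<close> vanish simultaneously on a subspace of dimension \<open>n - d\<close>. Taking \<open>g\<close>, \<open>h\<close> to be the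
  Hermitian parts of \<open>A - \<mu>\<close>, and \<open>d = n - k\<close>, this says that \<open>\<mu>\<close> lies in the rank-\<open>k\<close> numerical
  range as soon as the eigenvalue inequalities hold. The dual cone then comes from the bipolar
  theorem.

  The theorem on pencils is proved by induction on \<open>n\<close>. If an eigenvector \<open>x\<close> of the pencil is
  isotropic for \<open>g\<close> and \<open>h\<close>, pass to the orthogonal complement of \<open>x\<close> modulo \<open>x\<close>: the index drops by
  one. This covers nonreal eigenvalues, singular pencils and nontrivial Jordan blocks. Otherwise
  \<open>g\<close> and \<open>h\<close> are simultaneously diagonalizable, with real eigenvalues of definite sign. Then some
  hyperplane \<open>W\<close> reduces the index. The index of the restriction of \<open>g - t h\<close> to \<open>W\<close> is governed by
  the sign of a rational function of \<open>t\<close> with poles at eigenvalues and residues of prescribed sign.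
  Choosing the poles where the index passes between its two extreme values makes the signs
  alternate, so that \<open>1 / (\<Prod>\<sigma>\<in>S. \<sigma> - t)\<close> is such a function.
\<close>

section \<open>Families of vectors and Hermitian forms\<close>

text \<open>A single hyperplane \<open>W\<close> must lower the index of every form that attains
  \<open>d\<close>. Let \<open>p\<close> be a nondegenerate form of the pencil and write the
  functional cutting out \<open>W\<close> as \<open>p y\<close>. If \<open>p y y\<close> is
  negative, \<open>y\<close> enlarges every negative definite family in \<open>W\<close>, so the
  index on \<open>W\<close> is below \<open>d\<close>; if \<open>p y y\<close> is positive, the
  index on the whole space has to be below \<open>d\<close> already. For \<open>p = g - t h\<close>
  in a diagonalizing basis, with eigenvalues \<open>t_i\<close>, diagonal values \<open>h_i\<close>
  of \<open>h\<close> and a functional with real weights \<open>w_i\<close>, the number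
  \<open>p y y\<close> is the sum of \<open>w_i^2 h_i / (t_i - t)\<close>. This is the origin of the
  rational function, and the sign of \<open>h_i\<close> is the only restriction on its coefficients.
  The remaining obstacle is degenerate forms of the pencil, for which no such \<open>y\<close> need
  exist. A negative definite family stays negative definite under small perturbations, so an index
  that is too large at a degenerate form would also be too large at a nondegenerate one
  nearby.\<close>

lemma homogeneous_system:
  fixes c :: "'j \<Rightarrow> 'i \<Rightarrow> complex"
  assumes "finite J" "finite I" "card J < card I"
  shows "\<exists>a. (\<exists>i\<in>I. a i \<noteq> 0) \<and> (\<forall>j\<in>J. (\<Sum>i\<in>I. a i * c j i) = 0)"
  using assms
proof (induction J arbitrary: I c rule: finite_induct)
  case empty
  then obtain i where "i \<in> I" by (metis card.empty card_gt_0_iff equals0I)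
  then show ?case by (intro exI[of _ "\<lambda>_. 1"]) auto
next
  case (insert j J)
  show ?case
  proof (cases "\<forall>i\<in>I. c j i = 0")
    case True
    obtain a where "\<exists>i\<in>I. a i \<noteq> 0" "\<forall>j\<in>J. (\<Sum>i\<in>I. a i * c j i) = 0"
      using insert.IH[of I c] insert.prems insert.hyps by auto
    then show ?thesis using True by (intro exI[of _ a]) auto
  next
    case False
    then obtain p where p: "p \<in> I" "c j p \<noteq> 0" by auto
    define c' where "c' = (\<lambda>l i. c l i - c j i / c j p * c l p)"
    have "card J < card (I - {p})" using insert p by simp
    then obtain a' where a': "\<exists>i\<in>I - {p}. a' i \<noteq> 0"
      "\<forall>l\<in>J. (\<Sum>i\<in>I - {p}. a' i * c' l i) = 0"
      using insert.IH[of "I - {p}" c'] insert.prems by auto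
    define a where "a = a'(p := - (\<Sum>i\<in>I - {p}. a' i * c j i) / c j p)"
    have split: "(\<Sum>i\<in>I. a i * c l i) =
        - (\<Sum>i\<in>I - {p}. a' i * c j i) / c j p * c l p + (\<Sum>i\<in>I - {p}. a' i * c l i)" for l
    proof -
      have "(\<Sum>i\<in>I - {p}. a i * c l i) = (\<Sum>i\<in>I - {p}. a' i * c l i)"
        by (rule sum.cong) (auto simp: a_def)
      then show ?thesis using insert.prems p by (simp add: sum.remove[of I p] a_def)
    qed
    have "(\<Sum>i\<in>I. a i * c l i) = 0" if "l \<in> J" for l
    proof -
      have "0 = (\<Sum>i\<in>I - {p}. a' i * c' l i)" using a' that by simp
      also have "\<dots> = (\<Sum>i\<in>I - {p}. a' i * c l i) - (\<Sum>i\<in>I - {p}. a' i * c j i * (c l p / c j p))"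
        unfolding c'_def by (simp add: sum_subtractf[symmetric] algebra_simps)
      also have "\<dots> = (\<Sum>i\<in>I. a i * c l i)"
        unfolding split by (simp only: sum_distrib_right[symmetric]) simp
      finally show ?thesis by simp
    qed
    moreover have "(\<Sum>i\<in>I. a i * c j i) = 0" using p by (simp add: split)
    moreover have "\<exists>i\<in>I. a i \<noteq> 0" using a' by (auto simp: a_def)
    ultimately show ?thesis by blast
  qed
qed

locale complex_vector_space = vector_space scale
  for scale :: "complex \<Rightarrow> 'v::ab_group_add \<Rightarrow> 'v" (infixr "\<star>" 75)
begin

text \<open>Families are indexed by finite sets of naturals instead of initial segments, so that
  deleting a vector, or adjoining one at a fresh index, requires no renumbering.\<close>

definition lc :: "nat set \<Rightarrow> (nat \<Rightarrow> complex) \<Rightarrow> (nat \<Rightarrow> 'v) \<Rightarrow> 'v" where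
  "lc I a b = (\<Sum>i\<in>I. a i \<star> b i)"

definition indep :: "nat set \<Rightarrow> (nat \<Rightarrow> 'v) \<Rightarrow> bool" where
  "indep I b \<longleftrightarrow> (\<forall>a. lc I a b = 0 \<longrightarrow> (\<forall>i\<in>I. a i = 0))"

definition has_dim :: "'v set \<Rightarrow> nat \<Rightarrow> bool" where
  "has_dim U n \<longleftrightarrow>
     (\<exists>I e. finite I \<and> card I = n \<and> indep I e \<and> U = range (\<lambda>a. lc I a e))"

definition functional :: "('v \<Rightarrow> complex) \<Rightarrow> bool" where
  "functional \<phi> \<longleftrightarrow> (\<forall>u v. \<phi> (u + v) = \<phi> u + \<phi> v) \<and> (\<forall>c u. \<phi> (c \<star> u) = c * \<phi> u)"

definition hermitian_form :: "('v \<Rightarrow> 'v \<Rightarrow> complex) \<Rightarrow> bool" where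
  "hermitian_form f \<longleftrightarrow> (\<forall>u. functional (f u)) \<and> (\<forall>u v. f v u = cnj (f u v))"

text \<open>The real coefficients are homogeneous and of either sign. Hence \<open>- f\<close>
  belongs to the pencil along with \<open>f\<close>, and a bound on the negative index over the
  pencil also bounds the positive index.\<close>

definition pencil :: "('v \<Rightarrow> 'v \<Rightarrow> complex) \<Rightarrow> ('v \<Rightarrow> 'v \<Rightarrow> complex) \<Rightarrow> real \<Rightarrow> real \<Rightarrow> 'v \<Rightarrow> 'v \<Rightarrow> complex" where
  "pencil g h c s = (\<lambda>u v. of_real c * g u v + of_real s * h u v)"

definition neg_def_family :: "('v \<Rightarrow> 'v \<Rightarrow> complex) \<Rightarrow> nat set \<Rightarrow> (nat \<Rightarrow> 'v) \<Rightarrow> bool" where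
  "neg_def_family f I b \<longleftrightarrow>
     (\<forall>a. (\<exists>i\<in>I. a i \<noteq> 0) \<longrightarrow> Re (f (lc I a b) (lc I a b)) < 0)"

definition neg_orthonormal :: "('v \<Rightarrow> 'v \<Rightarrow> complex) \<Rightarrow> nat set \<Rightarrow> (nat \<Rightarrow> 'v) \<Rightarrow> bool" where
  "neg_orthonormal f I b \<longleftrightarrow> (\<forall>i\<in>I. \<forall>j\<in>I. f (b i) (b j) = (if i = j then - 1 else 0))"

text \<open>A lower bound for the index is monotone in \<open>U\<close> and makes sense for
  degenerate forms. For Hermitian \<open>f\<close> the family is automatically independent, because
  a vanishing combination would have value 0.\<close>

definition neg_index_ge :: "('v \<Rightarrow> 'v \<Rightarrow> complex) \<Rightarrow> 'v set \<Rightarrow> nat \<Rightarrow> bool" where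
  "neg_index_ge f U m \<longleftrightarrow>
     (\<exists>I b. finite I \<and> card I = m \<and> b ` I \<subseteq> U \<and> neg_def_family f I b)"

lemma lc_cong: "(\<And>i. i \<in> I \<Longrightarrow> a i = a' i) \<Longrightarrow> (\<And>i. i \<in> I \<Longrightarrow> b i = b' i) \<Longrightarrow> lc I a b = lc I a' b'"
  by (simp add: lc_def)

lemma lc_add: "lc I a b + lc I a' b = lc I (\<lambda>i. a i + a' i) b"
  by (simp add: lc_def scale_left_distrib sum.distrib)

lemma lc_scale: "c \<star> lc I a b = lc I (\<lambda>i. c * a i) b"
  by (simp add: lc_def scale_sum_right)

lemma lc_insert: "finite I \<Longrightarrow> j \<notin> I \<Longrightarrow> lc (insert j I) a b = a j \<star> b j + lc I a b"
  by (simp add: lc_def)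

lemma lc_remove: "finite I \<Longrightarrow> j \<in> I \<Longrightarrow> lc I a b = a j \<star> b j + lc (I - {j}) a b"
  by (simp add: lc_def sum.remove)

lemma lc_fun_upd: "j \<notin> I \<Longrightarrow> lc I (a(j := x)) b = lc I a b"
  by (rule lc_cong) auto

lemma lc_in_subspace: "subspace U \<Longrightarrow> b ` I \<subseteq> U \<Longrightarrow> lc I a b \<in> U"
  by (auto simp: lc_def intro!: subspace_sum subspace_scale)

lemma lc_lc: "finite I \<Longrightarrow> finite K \<Longrightarrow> lc I a (\<lambda>i. lc K (c i) b) = lc K (\<lambda>k. \<Sum>i\<in>I. a i * c i k) b"
  unfolding lc_def scale_sum_right scale_sum_left scale_scale by (subst sum.swap) simp

lemma lc_single: "finite I \<Longrightarrow> j \<in> I \<Longrightarrow> lc I (\<lambda>i. if i = j then 1 else 0) b = b j"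
proof -
  assume *: "finite I" "j \<in> I"
  have "lc I (\<lambda>i. if i = j then 1 else 0) b = (\<Sum>i\<in>I. if i = j then b j else 0)"
    unfolding lc_def by (rule sum.cong) auto
  then show ?thesis using * by simp
qed

lemma functional_lc: "functional \<phi> \<Longrightarrow> \<phi> (lc I a b) = (\<Sum>i\<in>I. a i * \<phi> (b i))"
proof -
  assume \<phi>: "functional \<phi>"
  then have "\<phi> 0 = 0" unfolding functional_def by (metis mult_zero_left scale_zero_left)
  then show ?thesis unfolding lc_def
    by (induction I rule: infinite_finite_induct) (use \<phi> in \<open>auto simp: functional_def\<close>)
qed

lemma hermitian_functional: "hermitian_form f \<Longrightarrow> functional (f u)"
  and hermitian_cnj: "hermitian_form f \<Longrightarrow> cnj (f u v) = f v u"
  unfolding hermitian_form_def by metis+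

lemma hermitian_add_right: "hermitian_form f \<Longrightarrow> f u (v + w) = f u v + f u w"
  and hermitian_scale_right: "hermitian_form f \<Longrightarrow> f u (c \<star> v) = c * f u v"
  using hermitian_functional unfolding functional_def by blast+

lemma hermitian_add_left: "hermitian_form f \<Longrightarrow> f (v + w) u = f v u + f w u"
  by (metis hermitian_add_right hermitian_cnj complex_cnj_add)

lemma hermitian_scale_left: "hermitian_form f \<Longrightarrow> f (c \<star> v) u = cnj c * f v u"
  by (metis hermitian_scale_right hermitian_cnj complex_cnj_mult)

lemma hermitian_lc_right: "hermitian_form f \<Longrightarrow> f u (lc I a b) = (\<Sum>i\<in>I. a i * f u (b i))"
  by (simp add: functional_lc hermitian_functional)

lemma hermitian_lc_left:
  assumes "hermitian_form f"
  shows "f (lc I a b) u = (\<Sum>i\<in>I. cnj (a i) * f (b i) u)"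
proof -
  have "f (lc I a b) u = cnj (f u (lc I a b))" using assms by (simp add: hermitian_cnj)
  then show ?thesis using assms by (simp add: hermitian_lc_right cnj_sum hermitian_cnj)
qed

lemma hermitian_zero: "hermitian_form f \<Longrightarrow> f u 0 = 0" "hermitian_form f \<Longrightarrow> f 0 u = 0"
  using hermitian_scale_right[of f u 0 0] hermitian_scale_left[of f 0 0 u] by auto

lemma hermitian_real: "hermitian_form f \<Longrightarrow> f u u = of_real (Re (f u u))"
  using hermitian_cnj[of f u u] by (simp add: complex_eq_iff)

lemma hermitian_pencil:
  assumes "hermitian_form g" "hermitian_form h" shows "hermitian_form (pencil g h c s)"
proof -
  have "functional (pencil g h c s u)" for u
    using assms unfolding functional_def pencil_def
    by (simp add: hermitian_add_right hermitian_scale_right algebra_simps)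
  moreover have "pencil g h c s v u = cnj (pencil g h c s u v)" for u v
    using assms unfolding pencil_def by (simp add: hermitian_cnj)
  ultimately show ?thesis unfolding hermitian_form_def by blast
qed

lemma pencil_pencil:
  "pencil (pencil g h c s) (pencil g h c' s') x y = pencil g h (x * c + y * c') (x * s + y * s')"
  by (auto simp: pencil_def algebra_simps)

section \<open>Bases, complements of a vector and kernels of functionals\<close>

lemma indep_subset:
  assumes "indep I b" "finite I" "J \<subseteq> I" shows "indep J b"
  unfolding indep_def
proof (intro allI impI)
  fix a assume *: "lc J a b = 0"
  have "lc I (\<lambda>i. if i \<in> J then a i else 0) b = lc J a b"
    unfolding lc_def using assms by (intro sum.mono_neutral_cong_right) auto
  then have *: "lc I (\<lambda>i. if i \<in> J then a i else 0) b = 0" using * by simp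
  have "\<forall>i\<in>I. (if i \<in> J then a i else 0) = 0"
    using assms(1)[unfolded indep_def, rule_format, OF *] by blast
  then show "\<forall>i\<in>J. a i = 0" using assms(3) by (metis subsetD)
qed

lemma subspace_range_lc: "subspace (range (\<lambda>a. lc I a e))"
proof (rule subspaceI)
  have "0 = lc I (\<lambda>_. 0) e" by (simp add: lc_def)
  then show "0 \<in> range (\<lambda>a. lc I a e)" by blast
qed (auto simp: lc_add lc_scale)

lemma has_dim_subspace: "has_dim U n \<Longrightarrow> subspace U"
  unfolding has_dim_def using subspace_range_lc by blast

text \<open>A basis vector that occurs in the expansion of \<open>x\<close> is dropped; by
  uniqueness of coefficients the span of the others misses \<open>x\<close>.\<close>

lemma has_dim_complement:
  assumes "has_dim U n" "x \<in> U" "x \<noteq> 0"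
  obtains U' where "U' \<subseteq> U" "has_dim U' (n - 1)" "x \<notin> U'"
proof -
  obtain I e where I: "finite I" "card I = n" "indep I e" and U: "U = range (\<lambda>a. lc I a e)"
    using assms unfolding has_dim_def by blast
  obtain a where a: "x = lc I a e" using assms U by auto
  have "\<exists>j\<in>I. a j \<noteq> 0"
  proof (rule ccontr)
    assume "\<not> ?thesis"
    then have "lc I a e = 0" by (simp add: lc_def)
    then show False using a assms by simp
  qed
  then obtain j where j: "j \<in> I" "a j \<noteq> 0" by blast
  define U' where "U' = range (\<lambda>a. lc (I - {j}) a e)"
  have ext: "lc (I - {j}) c e = lc I (c(j := 0)) e" for c
    using lc_remove[OF I(1) j(1), of "c(j := 0)" e] lc_cong[of "I - {j}" c "c(j:=0)" e e] by simp
  have "U' \<subseteq> U" unfolding U'_def U using ext by auto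
  moreover have "has_dim U' (n - 1)"
    unfolding has_dim_def U'_def
    by (intro exI[of _ "I - {j}"] exI[of _ e]) (use I j indep_subset[of I e] in auto)
  moreover have "x \<notin> U'"
  proof
    assume "x \<in> U'"
    then obtain c where c: "x = lc I (c(j := 0)) e" unfolding U'_def using ext by auto
    have "lc I (\<lambda>i. a i + (- 1) * (c(j:=0)) i) e = x + (- 1) \<star> x"
      by (metis a c lc_add lc_scale)
    also have "\<dots> = 0" by simp
    finally have "a j + (- 1) * (c(j:=0)) j = 0" using I(3) j(1) unfolding indep_def by blast
    then show False using j by simp
  qed
  ultimately show ?thesis using that by blast
qed

text \<open>Some basis vector \<open>e j\<close> lies outside the kernel. Correcting the other basis
  vectors by multiples of \<open>e j\<close> moves them into the kernel, and the condition
  \<open>\<phi> u = 0\<close> determines the coefficient of \<open>e j\<close> from the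
  others.\<close>

lemma has_dim_kernel:
  assumes "has_dim U n" "functional \<phi>" "y \<in> U" "\<phi> y \<noteq> 0"
  shows "has_dim {u \<in> U. \<phi> u = 0} (n - 1)"
proof -
  obtain I e where I: "finite I" "card I = n" "indep I e" and U: "U = range (\<lambda>a. lc I a e)"
    using assms unfolding has_dim_def by blast
  obtain a where a: "y = lc I a e" using assms U by auto
  have "\<exists>j\<in>I. \<phi> (e j) \<noteq> 0"
  proof (rule ccontr)
    assume "\<not> ?thesis"
    then have "\<phi> (lc I a e) = 0" by (simp add: functional_lc assms)
    then show False using a assms by simp
  qed
  then obtain j where j: "j \<in> I" "\<phi> (e j) \<noteq> 0" by blast
  define J where "J = I - {j}"
  define e' where "e' = (\<lambda>i. e i + (- \<phi> (e i) / \<phi> (e j)) \<star> e j)"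
  have J: "finite J" "card J = n - 1" "j \<notin> J" using I j by (auto simp: J_def)
  have lcI: "lc I c e = c j \<star> e j + lc J c e" for c using lc_remove[OF I(1) j(1)] by (simp add: J_def)
  have e': "lc J c e' = lc I (c(j := - (\<Sum>i\<in>J. c i * \<phi> (e i)) / \<phi> (e j))) e" for c
  proof -
    have "lc J c e' = lc J c e + (\<Sum>i\<in>J. c i * (- \<phi> (e i) / \<phi> (e j))) \<star> e j"
      unfolding lc_def e'_def scale_right_distrib sum.distrib scale_scale scale_sum_left ..
    also have "(\<Sum>i\<in>J. c i * (- \<phi> (e i) / \<phi> (e j))) = - (\<Sum>i\<in>J. c i * \<phi> (e i)) / \<phi> (e j)"
      by (simp add: sum_divide_distrib sum_negf)
    finally show ?thesis
      unfolding lcI using J(3) by (simp add: lc_fun_upd)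
  qed
  have "{u \<in> U. \<phi> u = 0} = range (\<lambda>a. lc J a e')"
  proof (intro equalityI subsetI)
    fix u assume "u \<in> {u \<in> U. \<phi> u = 0}"
    then obtain c where c: "u = lc I c e" "\<phi> u = 0" unfolding U by auto
    then have "(\<Sum>i\<in>I. c i * \<phi> (e i)) = 0" by (simp add: functional_lc assms)
    then have "c j * \<phi> (e j) + (\<Sum>i\<in>J. c i * \<phi> (e i)) = 0"
      using I j by (simp add: sum.remove J_def)
    then have "c j = - (\<Sum>i\<in>J. c i * \<phi> (e i)) / \<phi> (e j)"
      using j by (simp add: field_simps eq_neg_iff_add_eq_0)
    then have "c(j := - (\<Sum>i\<in>J. c i * \<phi> (e i)) / \<phi> (e j)) = c" by auto
    then show "u \<in> range (\<lambda>a. lc J a e')" using e'[of c] c by (metis rangeI)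
  next
    fix u assume "u \<in> range (\<lambda>a. lc J a e')"
    then obtain c where c: "u = lc J c e'" by auto
    have "\<phi> (e' i) = \<phi> (e i) + - \<phi> (e i) / \<phi> (e j) * \<phi> (e j)" for i
      using assms(2) unfolding e'_def functional_def by metis
    then have "\<phi> (e' i) = 0" for i using j(2) by simp
    then have "\<phi> u = 0" unfolding c by (simp add: functional_lc assms)
    then show "u \<in> {u \<in> U. \<phi> u = 0}" using c e' unfolding U by auto
  qed
  moreover have "indep J e'"
    unfolding indep_def
  proof (intro allI impI ballI)
    fix c i assume *: "lc J c e' = 0" "i \<in> J"
    have "\<forall>i\<in>I. (c(j := - (\<Sum>i\<in>J. c i * \<phi> (e i)) / \<phi> (e j))) i = 0"
      using *(1) I(3) unfolding e' indep_def by blast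
    then show "c i = 0" using *(2) J(3) by (metis DiffD1 J_def fun_upd_other)
  qed
  ultimately show ?thesis unfolding has_dim_def using J by blast
qed

section \<open>Negative definite families and their extension\<close>

lemma neg_orthonormal_form:
  assumes "hermitian_form f" "neg_orthonormal f I b" "finite I"
  shows "f (lc I a b) (lc I a b) = - of_real (\<Sum>i\<in>I. (cmod (a i))\<^sup>2)"
proof -
  have "f (lc I a b) (lc I a b) = (\<Sum>i\<in>I. cnj (a i) * (\<Sum>j\<in>I. a j * f (b i) (b j)))"
    using assms by (simp add: hermitian_lc_left hermitian_lc_right)
  also have "\<dots> = (\<Sum>i\<in>I. cnj (a i) * (\<Sum>j\<in>I. if i = j then - a j else 0))"
    using assms(2) unfolding neg_orthonormal_def
    by (intro sum.cong refl arg_cong2[where f = "(*)"]) auto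
  also have "\<dots> = (\<Sum>i\<in>I. - of_real ((cmod (a i))\<^sup>2))"
    using assms(3) by (intro sum.cong refl) (simp add: complex_norm_square[symmetric] mult.commute[of "cnj _"] del: of_real_power)
  finally show ?thesis by (simp add: sum_negf)
qed

lemma neg_orthonormal_imp_neg_def:
  assumes "hermitian_form f" "neg_orthonormal f I b" "finite I"
  shows "neg_def_family f I b"
  unfolding neg_def_family_def
proof (intro allI impI)
  fix a :: "nat \<Rightarrow> complex" assume "\<exists>i\<in>I. a i \<noteq> 0"
  then have "0 < (\<Sum>i\<in>I. (cmod (a i))\<^sup>2)"
    using assms(3) by (auto intro: sum_pos2)
  then show "Re (f (lc I a b) (lc I a b)) < 0"
    unfolding neg_orthonormal_form[OF assms] by simp
qed

lemma neg_orthonormal_insert: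
  assumes "hermitian_form f" "neg_orthonormal f I b" "j \<notin> I"
    and "\<And>i. i \<in> I \<Longrightarrow> f (b i) z = 0" "Re (f z z) < 0"
  shows "neg_orthonormal f (insert j I) (b(j := of_real (1 / sqrt (- Re (f z z))) \<star> z))"
proof -
  define q where "q = Re (f z z)"
  define r where "r = 1 / sqrt (- q)"
  have q: "q < 0" "f z z = of_real q" using assms(5) hermitian_real[OF assms(1), of z] by (simp_all add: q_def)
  have "f (of_real r \<star> z) (of_real r \<star> z) = of_real (r * r * q)"
    using assms(1) q(2) by (simp add: hermitian_scale_left hermitian_scale_right)
  also have "r * r * q = - 1"
    unfolding r_def using q(1) by (simp add: field_simps)
  finally have "f (of_real r \<star> z) (of_real r \<star> z) = - 1" by simp
  moreover have "f (b i) (of_real r \<star> z) = 0" "f (of_real r \<star> z) (b i) = 0" if "i \<in> I" for i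
  proof -
    show 1: "f (b i) (of_real r \<star> z) = 0"
      using assms(1,4) that by (simp add: hermitian_scale_right)
    show "f (of_real r \<star> z) (b i) = 0" using hermitian_cnj[OF assms(1), of "b i" "of_real r \<star> z"] 1 by simp
  qed
  ultimately show ?thesis
    using assms(2,3) unfolding neg_orthonormal_def q_def[symmetric] r_def[symmetric] by auto
qed

text \<open>Since \<open>f (b l) (b l)\<close> is - 1, orthogonal projection adds the components
  along \<open>b\<close> where the positive definite case would subtract them.\<close>

lemma neg_orthonormal_project:
  assumes "hermitian_form f" "neg_orthonormal f I b" "finite I" "i \<in> I"
  shows "f (b i) (y + lc I (\<lambda>l. f (b l) y) b) = 0"
proof -
  have "f (b i) (lc I (\<lambda>l. f (b l) y) b) = (\<Sum>l\<in>I. f (b l) y * f (b i) (b l))"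
    using assms by (simp add: hermitian_lc_right)
  also have "\<dots> = (\<Sum>l\<in>I. if i = l then - f (b l) y else 0)"
    using assms(2,4) unfolding neg_orthonormal_def by (intro sum.cong refl) auto
  also have "\<dots> = - f (b i) y" using assms(3,4) by simp
  finally show ?thesis using assms(1) by (simp add: hermitian_add_right)
qed

text \<open>The coefficients are part of the result, so that the new family visibly lies in the span
  of \<open>b\<close> and inherits membership in a subspace, or isotropy for other forms.\<close>

lemma Gram_Schmidt:
  assumes "hermitian_form f" "finite I" "neg_def_family f I b"
  obtains c where "neg_orthonormal f I (\<lambda>i. lc I (c i) b)"
proof -
  have "\<exists>c. neg_orthonormal f I (\<lambda>i. lc I (c i) b)"
    using assms(2,3)
  proof (induction I rule: finite_induct)
    case empty
    show ?case by (simp add: neg_orthonormal_def)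
  next
    case (insert j I)
    have ext: "lc I a b = lc (insert j I) (a(j := 0)) b" for a
      using insert.hyps by (simp add: lc_insert lc_fun_upd)
    have "neg_def_family f I b"
      unfolding neg_def_family_def
    proof (intro allI impI)
      fix a :: "nat \<Rightarrow> complex" assume "\<exists>i\<in>I. a i \<noteq> 0"
      then have "\<exists>i\<in>insert j I. (a(j := 0)) i \<noteq> 0" using insert.hyps by auto
      then show "Re (f (lc I a b) (lc I a b)) < 0"
        unfolding ext using insert.prems unfolding neg_def_family_def by blast
    qed
    from insert.IH[OF this] obtain c where c: "neg_orthonormal f I (\<lambda>i. lc I (c i) b)" ..
    define b' where "b' = (\<lambda>i. lc I (c i) b)"
    define a where "a = (\<lambda>l. f (b' l) (b j))"
    define z where "z = b j + lc I a b'"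
    \<comment> \<open>The coordinates of \<open>z\<close> in the original family. The entry 1 at
      \<open>j\<close> makes them nonzero, so that negative definiteness applies to
      \<open>z\<close>.\<close>
    define d where "d = (\<lambda>k. \<Sum>i\<in>I. a i * c i k)(j := 1)"
    have "lc I a b' = lc I (\<lambda>k. \<Sum>i\<in>I. a i * c i k) b"
      unfolding b'_def using insert.hyps by (simp add: lc_lc)
    also have "\<dots> = lc I d b" by (rule lc_cong) (use insert.hyps in \<open>auto simp: d_def\<close>)
    finally have z: "z = lc (insert j I) d b"
      unfolding z_def using insert.hyps by (simp add: lc_insert d_def)
    have "\<exists>i\<in>insert j I. d i \<noteq> 0" by (simp add: d_def)
    then have neg: "Re (f z z) < 0" unfolding z using insert.prems unfolding neg_def_family_def by blast
    define r where "r = complex_of_real (1 / sqrt (- Re (f z z)))"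
    have orth: "f (b' i) z = 0" if "i \<in> I" for i
      unfolding z_def a_def using that insert.hyps assms(1) c neg_orthonormal_project by (simp add: b'_def)
    have "neg_orthonormal f (insert j I) (b'(j := r \<star> z))"
      unfolding r_def using neg_orthonormal_insert[OF assms(1) _ insert.hyps(2) orth neg] c
      by (simp add: b'_def)
    moreover have "b'(j := r \<star> z) = (\<lambda>i. lc (insert j I) (((\<lambda>i. (c i)(j := 0))(j := (\<lambda>k. r * d k))) i) b)"
      by (auto simp: b'_def ext z lc_scale)
    ultimately show ?case by metis
  qed
  then show ?thesis using that by blast
qed

lemma neg_index_geE:
  assumes "neg_index_ge f U m" "hermitian_form f" "subspace U"
  obtains I b where "finite I" "card I = m" "b ` I \<subseteq> U" "neg_orthonormal f I b"
proof -
  obtain I b where I: "finite I" "card I = m" "b ` I \<subseteq> U" "neg_def_family f I b"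
    using assms unfolding neg_index_ge_def by blast
  obtain c where "neg_orthonormal f I (\<lambda>i. lc I (c i) b)" using Gram_Schmidt assms I by blast
  moreover have "(\<lambda>i. lc I (c i) b) ` I \<subseteq> U" using lc_in_subspace[OF assms(3)] I by blast
  ultimately show ?thesis using that I by blast
qed

text \<open>Index drops are obtained from this: if a family in a smaller subspace can always be
  enlarged by a negative vector of \<open>U\<close>, the index on the smaller subspace is strictly
  below the bound on \<open>U\<close>.\<close>

lemma neg_index_ge_Suc:
  assumes "hermitian_form f" "neg_orthonormal f I b" "finite I" "b ` I \<subseteq> U" "subspace U"
    and "\<And>i. i \<in> I \<Longrightarrow> f (b i) z = 0" "Re (f z z) < 0" "z \<in> U"
  shows "neg_index_ge f U (Suc (card I))"
proof -
  obtain j where j: "j \<notin> I" using assms(3) ex_new_if_finite[OF infinite_UNIV_nat] by blast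
  define b' where "b' = b(j := of_real (1 / sqrt (- Re (f z z))) \<star> z)"
  have "neg_orthonormal f (insert j I) b'"
    unfolding b'_def using neg_orthonormal_insert[OF assms(1,2) j assms(6,7)] .
  then have "neg_def_family f (insert j I) b'"
    using neg_orthonormal_imp_neg_def assms by blast
  moreover have "b' ` insert j I \<subseteq> U" using assms j by (auto simp: b'_def intro: subspace_scale)
  ultimately show ?thesis unfolding neg_index_ge_def using assms(3) j
    by (intro exI[of _ "insert j I"] exI[of _ b']) auto
qed

lemma neg_index_ge_mono: "neg_index_ge f U m \<Longrightarrow> U \<subseteq> V \<Longrightarrow> neg_index_ge f V m"
  unfolding neg_index_ge_def by blast

lemma neg_index_ge_0: "neg_index_ge f U 0"
  unfolding neg_index_ge_def neg_def_family_def by (intro exI[of _ "{}"]) auto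

text \<open>On the span of a negative orthonormal family, \<open>f\<close> is minus the sum of
  squares of the coordinates, while \<open>f'\<close> is at most \<open>M\<close> times that sum. So
  \<epsilon> below \<open>1 / (M + 1)\<close> preserves negativity; the added 1 covers
  \<open>M = 0\<close>.\<close>

lemma neg_index_ge_perturb:
  assumes "neg_index_ge f U m" "hermitian_form f" "hermitian_form f'" "subspace U"
  obtains \<delta> where "\<delta> > 0" "\<And>\<epsilon>. 0 < \<epsilon> \<Longrightarrow> \<epsilon> < \<delta> \<Longrightarrow> neg_index_ge (pencil f f' 1 \<epsilon>) U m"
proof -
  obtain I b where I: "finite I" "card I = m" "b ` I \<subseteq> U" "neg_orthonormal f I b"
    using neg_index_geE assms by metis
  define M where "M = (\<Sum>i\<in>I. \<Sum>j\<in>I. cmod (f' (b i) (b j)))"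
  have M: "M \<ge> 0" unfolding M_def by (intro sum_nonneg) auto
  have bound: "cmod (f' (lc I a b) (lc I a b)) \<le> M * (\<Sum>i\<in>I. (cmod (a i))\<^sup>2)" for a
  proof -
    let ?S = "\<Sum>i\<in>I. (cmod (a i))\<^sup>2"
    have prod: "cmod (a i) * cmod (a j) \<le> ?S" if "i \<in> I" "j \<in> I" for i j
    proof -
      have "(cmod (a i))\<^sup>2 \<le> ?S" "(cmod (a j))\<^sup>2 \<le> ?S"
        using I(1) that by (auto intro: member_le_sum)
      moreover have "2 * (cmod (a i) * cmod (a j)) \<le> (cmod (a i))\<^sup>2 + (cmod (a j))\<^sup>2"
        using sum_squares_bound[of "cmod (a i)" "cmod (a j)"] by (simp add: mult.assoc)
      ultimately show ?thesis by linarith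
    qed
    have "f' (lc I a b) (lc I a b) = (\<Sum>i\<in>I. \<Sum>j\<in>I. cnj (a i) * (a j * f' (b i) (b j)))"
      using assms(3) by (simp add: hermitian_lc_left hermitian_lc_right sum_distrib_left)
    also have "cmod \<dots> \<le> (\<Sum>i\<in>I. \<Sum>j\<in>I. cmod (cnj (a i) * (a j * f' (b i) (b j))))"
      by (rule order.trans[OF norm_sum], intro sum_mono, rule norm_sum)
    also have "\<dots> \<le> (\<Sum>i\<in>I. \<Sum>j\<in>I. cmod (f' (b i) (b j)) * ?S)"
    proof (intro sum_mono)
      fix i j assume "i \<in> I" "j \<in> I"
      then have "cmod (f' (b i) (b j)) * (cmod (a i) * cmod (a j)) \<le> cmod (f' (b i) (b j)) * ?S"
        using prod by (intro mult_left_mono) auto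
      then show "cmod (cnj (a i) * (a j * f' (b i) (b j))) \<le> cmod (f' (b i) (b j)) * ?S"
        by (simp add: norm_mult mult_ac)
    qed
    also have "\<dots> = M * ?S" unfolding M_def by (simp add: sum_distrib_right)
    finally show ?thesis .
  qed
  show ?thesis
  proof (rule that[of "1 / (M + 1)"])
    show "1 / (M + 1) > 0" using M by simp
  next
    fix \<epsilon> :: real assume \<epsilon>: "0 < \<epsilon>" "\<epsilon> < 1 / (M + 1)"
    have "\<epsilon> * M \<le> \<epsilon> * (M + 1)" using \<epsilon> by simp
    also have "\<dots> < 1" using \<epsilon> M by (simp add: pos_less_divide_eq)
    finally have \<epsilon>M: "\<epsilon> * M < 1" .
    have "neg_def_family (pencil f f' 1 \<epsilon>) I b"
      unfolding neg_def_family_def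
    proof (intro allI impI)
      fix a :: "nat \<Rightarrow> complex" assume nz: "\<exists>i\<in>I. a i \<noteq> 0"
      let ?S = "\<Sum>i\<in>I. (cmod (a i))\<^sup>2"
      have S: "0 < ?S" using nz I(1) by (auto intro: sum_pos2)
      have "Re (f' (lc I a b) (lc I a b)) \<le> M * ?S"
        using bound[of a] complex_Re_le_cmod order.trans by blast
      then have "\<epsilon> * Re (f' (lc I a b) (lc I a b)) \<le> \<epsilon> * M * ?S"
        using \<epsilon> by simp
      also have "\<dots> < 1 * ?S" using \<epsilon>M S by (rule mult_strict_right_mono)
      finally show "Re (pencil f f' 1 \<epsilon> (lc I a b) (lc I a b)) < 0"
        unfolding pencil_def by (simp add: neg_orthonormal_form[OF assms(2) I(4,1)])
    qed
    then show "neg_index_ge (pencil f f' 1 \<epsilon>) U m" unfolding neg_index_ge_def using I by blast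
  qed
qed

end

section \<open>Eigenvectors of Hermitian pencils\<close>

text \<open>A kernel vector of a singular \<open>H\<close> serves; otherwise take an eigenvector of
  the inverse of \<open>H\<close> times \<open>G\<close>. Homogeneous coefficients treat the
  eigenvalue at infinity like the others.\<close>

lemma pencil_null_vector:
  fixes G H :: "complex mat"
  assumes G: "G \<in> carrier_mat n n" and H: "H \<in> carrier_mat n n" and n: "0 < n"
  shows "\<exists>v \<alpha> \<beta>. v \<in> carrier_vec n \<and> v \<noteq> 0\<^sub>v n \<and> (\<alpha> \<noteq> 0 \<or> \<beta> \<noteq> 0) \<and>
    (\<forall>i<n. \<alpha> * (G *\<^sub>v v) $ i + \<beta> * (H *\<^sub>v v) $ i = 0)"
proof (cases "det H = 0")
  case True
  then obtain v where "v \<in> carrier_vec n" "v \<noteq> 0\<^sub>v n" "H *\<^sub>v v = 0\<^sub>v n"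
    using det_0_iff_vec_prod_zero[OF H] by blast
  then show ?thesis by (intro exI[of _ v] exI[of _ 0] exI[of _ 1]) auto
next
  case False
  obtain B where B: "B \<in> carrier_mat n n" "H * B = 1\<^sub>m n"
    using det_non_zero_imp_unit[OF H False, unfolded Units_def ring_mat_def] by auto
  have BG: "B * G \<in> carrier_mat n n" using B G by simp
  obtain k where "k \<in> spectrum (B * G)" using spectrum_non_empty[OF BG] n by auto
  then obtain v where v: "v \<in> carrier_vec n" "v \<noteq> 0\<^sub>v n" "B * G *\<^sub>v v = k \<cdot>\<^sub>v v"
    using BG unfolding spectrum_def eigenvalue_def eigenvector_def by auto
  have "G *\<^sub>v v = (H * B) * G *\<^sub>v v" using B G by simp
  also have "\<dots> = H *\<^sub>v (B * G *\<^sub>v v)"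
    by (simp only: assoc_mult_mat[OF H B(1) G] assoc_mult_mat_vec[OF H BG v(1)])
  also have "\<dots> = k \<cdot>\<^sub>v (H *\<^sub>v v)" unfolding v(3) using mult_mat_vec[OF H v(1)] .
  finally have "1 * (G *\<^sub>v v) $ i + - k * (H *\<^sub>v v) $ i = 0" if "i < n" for i
    using that H by simp
  then show ?thesis using v by (intro exI[of _ v] exI[of _ 1] exI[of _ "- k"]) auto
qed

section \<open>Simultaneous diagonalization and isotropic eigenvectors\<close>

context complex_vector_space
begin

text \<open>The relation is tested only against \<open>U\<close>, so it concerns the restricted
  forms. The coefficients are complex: if their ratio is not real, the relation at
  \<open>u = x\<close> forces the real numbers \<open>g x x\<close> and \<open>h x x\<close> to
  vanish.\<close>

definition pencil_eigenvector where
  "pencil_eigenvector g h U x \<longleftrightarrow> x \<in> U \<and> x \<noteq> 0 \<and>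
     (\<exists>\<alpha> \<beta> :: complex. (\<alpha> \<noteq> 0 \<or> \<beta> \<noteq> 0) \<and> (\<forall>u\<in>U. \<alpha> * g u x + \<beta> * h u x = 0))"

definition isotropic_family where
  "isotropic_family g h I w \<longleftrightarrow> (\<forall>i\<in>I. \<forall>j\<in>I. g (w i) (w j) = (0::complex) \<and> h (w i) (w j) = (0::complex))"

definition isotropic_dim_ge where
  "isotropic_dim_ge g h U k \<longleftrightarrow>
     (\<exists>I w. finite I \<and> card I = k \<and> w ` I \<subseteq> U \<and> indep I w \<and> isotropic_family g h I w)"

text \<open>Renumbering a basis by \<open>{..<n}\<close> prepares the passage to Gram
  matrices.\<close>

lemma has_dim_lessThan:
  assumes "has_dim U n"
  obtains e where "indep {..<n} e" "U = range (\<lambda>a. lc {..<n} a e)"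
proof -
  obtain I e where I: "finite I" "card I = n" "indep I e" and U: "U = range (\<lambda>a. lc I a e)"
    using assms unfolding has_dim_def by blast
  obtain f where f: "bij_betw f {..<n} I"
    using I ex_bij_betw_nat_finite[of I] by (auto simp: atLeast0LessThan)
  have lc: "lc I a e = lc {..<n} (a \<circ> f) (e \<circ> f)" for a
    unfolding lc_def using sum.reindex_bij_betw[OF f, of "\<lambda>i. a i \<star> e i"] by simp
  define g where "g = inv_into {..<n} f"
  have g: "f (g i) = i" "g i \<in> {..<n}" if "i \<in> I" for i
    using f that unfolding g_def bij_betw_def by (auto intro: f_inv_into_f inv_into_into)
  have gf: "g (f i) = i" "f i \<in> I" if "i \<in> {..<n}" for i
    using f that unfolding g_def bij_betw_def by auto
  have lc': "lc {..<n} a (e \<circ> f) = lc I (a \<circ> g) e" for a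
    unfolding lc by (rule lc_cong) (auto simp: gf)
  have "indep {..<n} (e \<circ> f)"
    unfolding indep_def
  proof (intro allI impI ballI)
    fix a i assume "lc {..<n} a (e \<circ> f) = 0" "i \<in> {..<n}"
    then have "(a \<circ> g) (f i) = 0" unfolding lc' using I(3) gf unfolding indep_def by blast
    then show "a i = 0" using gf \<open>i \<in> {..<n}\<close> by simp
  qed
  moreover have "U = range (\<lambda>a. lc {..<n} a (e \<circ> f))"
    unfolding U by (intro equalityI subsetI; clarsimp) (metis lc lc' rangeI)+
  ultimately show ?thesis using that by blast
qed

lemma pencil_eigenvector_exists:
  assumes "hermitian_form g" "hermitian_form h" "has_dim U n" "0 < n"
  obtains x where "pencil_eigenvector g h U x"
proof -
  obtain e where e: "indep {..<n} e" and U: "U = range (\<lambda>a. lc {..<n} a e)"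
    by (rule has_dim_lessThan[OF assms(3)])
  \<comment> \<open>\<open>M f\<close> is the Gram matrix of \<open>f\<close> in the basis
    \<open>e\<close>; a null vector of the matrix pencil is the coordinate vector of an
    eigenvector.\<close>
  define M where "M = (\<lambda>f :: 'v \<Rightarrow> 'v \<Rightarrow> complex. mat n n (\<lambda>(i, j). f (e i) (e j)))"
  have M: "M f \<in> carrier_mat n n" for f by (simp add: M_def)
  obtain v \<alpha> \<beta> where v: "v \<in> carrier_vec n" "v \<noteq> 0\<^sub>v n" "\<alpha> \<noteq> 0 \<or> \<beta> \<noteq> 0"
    "\<And>i. i < n \<Longrightarrow> \<alpha> * (M g *\<^sub>v v) $ i + \<beta> * (M h *\<^sub>v v) $ i = 0"
    using pencil_null_vector[OF M M assms(4)] by blast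
  define x where "x = lc {..<n} (\<lambda>i. v $ i) e"
  have f: "f (lc {..<n} c e) x = (\<Sum>i<n. cnj (c i) * (M f *\<^sub>v v) $ i)" if "hermitian_form f" for f c
  proof -
    have "(M f *\<^sub>v v) $ i = (\<Sum>j<n. v $ j * f (e i) (e j))" if "i < n" for i
      using that v(1) by (simp add: M_def scalar_prod_def atLeast0LessThan mult.commute)
    then show ?thesis
      unfolding x_def using that by (simp add: hermitian_lc_left hermitian_lc_right)
  qed
  have "x \<noteq> 0"
  proof
    assume "x = 0"
    then have "\<forall>i<n. v $ i = 0" using e unfolding x_def indep_def by auto
    then have "v = 0\<^sub>v n" using v(1) by (intro eq_vecI) auto
    then show False using v by simp
  qed
  moreover have "\<alpha> * g u x + \<beta> * h u x = 0" if uU: "u \<in> U" for u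
  proof -
    obtain c where u: "u = lc {..<n} c e" using uU U by blast
    have "\<alpha> * g u x + \<beta> * h u x =
        (\<Sum>i<n. cnj (c i) * (\<alpha> * (M g *\<^sub>v v) $ i + \<beta> * (M h *\<^sub>v v) $ i))"
      unfolding u f[OF assms(1)] f[OF assms(2)]
      unfolding sum_distrib_left sum.distrib[symmetric]
      by (intro sum.cong refl) (simp only: distrib_left mult.left_commute)
    then show ?thesis using v(4) by simp
  qed
  moreover have "x \<in> U" unfolding U x_def by (rule rangeI)
  ultimately have "pencil_eigenvector g h U x"
    using v(3) unfolding pencil_eigenvector_def by blast
  then show ?thesis by (rule that)
qed

text \<open>An eigenvector \<open>x\<close> is nonisotropic for one form \<open>f\<close> of the
  two, and its \<open>f\<close>-orthogonal complement in \<open>U\<close> is orthogonal to it for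
  both. As \<open>x\<close> is orthogonal to the complement, an eigenvector there is an eigenvector
  of \<open>U\<close>, so the hypothesis is inherited.\<close>

lemma simultaneous_diagonalization:
  assumes "hermitian_form g" "hermitian_form h" "has_dim U n"
    and "\<And>x. pencil_eigenvector g h U x \<Longrightarrow> g x x \<noteq> 0 \<or> h x x \<noteq> 0"
  shows "\<exists>I v. finite I \<and> card I = n \<and> U = range (\<lambda>a. lc I a v) \<and>
    (\<forall>i\<in>I. \<forall>j\<in>I. i \<noteq> j \<longrightarrow> g (v i) (v j) = 0 \<and> h (v i) (v j) = 0) \<and>
    (\<forall>i\<in>I. g (v i) (v i) \<noteq> 0 \<or> h (v i) (v i) \<noteq> 0)"
  using assms(3,4)
proof (induction n arbitrary: U)
  case 0
  then have "U = range (\<lambda>a. lc {} a v)" for v unfolding has_dim_def by (auto simp: lc_def)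
  then show ?case by (intro exI[of _ "{}"] exI) auto
next
  case (Suc n)
  obtain x where x: "pencil_eigenvector g h U x"
    using pencil_eigenvector_exists[OF assms(1,2) Suc.prems(1)] by auto
  then obtain \<alpha> \<beta> where xU: "x \<in> U" and \<alpha>\<beta>: "\<alpha> \<noteq> 0 \<or> \<beta> \<noteq> 0"
    "\<And>u. u \<in> U \<Longrightarrow> \<alpha> * g u x + \<beta> * h u x = 0"
    unfolding pencil_eigenvector_def by blast
  have x0: "g x x \<noteq> 0 \<or> h x x \<noteq> 0" using Suc.prems(2)[OF x] .
  define f where "f = (if g x x \<noteq> 0 then g else h)"
  have f: "hermitian_form f" "f x x \<noteq> 0" using assms x0 by (auto simp: f_def)
  define U' where "U' = {u \<in> U. f x u = 0}"
  have U': "has_dim U' n"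
    unfolding U'_def using has_dim_kernel[OF Suc.prems(1) hermitian_functional[OF f(1), of x] xU f(2)] by simp
  note sub = has_dim_subspace[OF Suc.prems(1)]
  have orth: "g u x = 0 \<and> h u x = 0" if "u \<in> U'" for u
  proof -
    have u: "u \<in> U" "f u x = 0" using that hermitian_cnj[OF f(1), of x u] by (auto simp: U'_def)
    \<comment> \<open>Because \<open>f x x\<close> is nonzero, the relation at \<open>x\<close>
      shows that the coefficient of the form other than \<open>f\<close> is nonzero; the relation at
      \<open>u\<close> then kills that form too.\<close>
    show ?thesis using \<alpha>\<beta>(1) \<alpha>\<beta>(2)[OF u(1)] \<alpha>\<beta>(2)[OF xU] u(2) x0
      by (cases "g x x = 0") (auto simp: f_def)
  qed
  then have orth': "g x u = 0 \<and> h x u = 0" if "u \<in> U'" for u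
    using that hermitian_cnj[OF assms(1), of u x] hermitian_cnj[OF assms(2), of u x] by auto
  have decomp: "u + (- (f x u / f x x)) \<star> x \<in> U'" if "u \<in> U" for u
    unfolding U'_def using that xU sub f
    by (auto simp: hermitian_add_right hermitian_scale_right
        simp del: scale_minus_left intro!: subspace_add subspace_scale)
  have nonisotropic: "g y y \<noteq> 0 \<or> h y y \<noteq> 0" if y: "pencil_eigenvector g h U' y" for y
  proof -
    obtain \<alpha>' \<beta>' where \<alpha>\<beta>': "\<alpha>' \<noteq> 0 \<or> \<beta>' \<noteq> 0" "y \<in> U'" "y \<noteq> 0"
      "\<And>u. u \<in> U' \<Longrightarrow> \<alpha>' * g u y + \<beta>' * h u y = 0"
      using y unfolding pencil_eigenvector_def by blast
    have "\<alpha>' * g u y + \<beta>' * h u y = 0" if "u \<in> U" for u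
      using \<alpha>\<beta>'(4)[OF decomp[OF that]] orth'[OF \<alpha>\<beta>'(2)] assms(1,2)
      by (simp add: hermitian_add_left hermitian_scale_left del: scale_minus_left)
    then have "pencil_eigenvector g h U y"
      unfolding pencil_eigenvector_def using \<alpha>\<beta>' U'_def by blast
    then show ?thesis using Suc.prems(2) by blast
  qed
  have "\<exists>I v. finite I \<and> card I = n \<and> U' = range (\<lambda>a. lc I a v) \<and>
    (\<forall>i\<in>I. \<forall>j\<in>I. i \<noteq> j \<longrightarrow> g (v i) (v j) = 0 \<and> h (v i) (v j) = 0) \<and>
    (\<forall>i\<in>I. g (v i) (v i) \<noteq> 0 \<or> h (v i) (v i) \<noteq> 0)"
    by (rule Suc.IH[OF U']) (rule nonisotropic)
  then obtain I v where "finite I \<and> card I = n \<and> U' = range (\<lambda>a. lc I a v) \<and>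
    (\<forall>i\<in>I. \<forall>j\<in>I. i \<noteq> j \<longrightarrow> g (v i) (v j) = 0 \<and> h (v i) (v j) = 0) \<and>
    (\<forall>i\<in>I. g (v i) (v i) \<noteq> 0 \<or> h (v i) (v i) \<noteq> 0)" by (elim exE)
  then have I: "finite I" "card I = n" "U' = range (\<lambda>a. lc I a v)"
    "\<And>i j. i \<in> I \<Longrightarrow> j \<in> I \<Longrightarrow> i \<noteq> j \<Longrightarrow> g (v i) (v j) = 0 \<and> h (v i) (v j) = 0"
    "\<And>i. i \<in> I \<Longrightarrow> g (v i) (v i) \<noteq> 0 \<or> h (v i) (v i) \<noteq> 0" by simp_all
  obtain j where j: "j \<notin> I" using I(1) ex_new_if_finite[OF infinite_UNIV_nat] by blast
  define v' where "v' = v(j := x)"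
  have v'I: "v' i = v i" if "i \<in> I" for i using that j by (auto simp: v'_def)
  have vU: "v i \<in> U'" if "i \<in> I" for i
    unfolding I(3) using lc_single[OF I(1) that, of v] by (metis rangeI)
  have lc: "lc (insert j I) a v' = a j \<star> x + lc I a v" for a
    using lc_insert[OF I(1) j] lc_cong[of I a a v' v] v'I by (simp add: v'_def)
  have "U = range (\<lambda>a. lc (insert j I) a v')"
  proof (intro equalityI subsetI)
    fix u assume "u \<in> U"
    then obtain a where a: "u + (- (f x u / f x x)) \<star> x = lc I a v"
      using decomp unfolding I(3) by blast
    have "u = (f x u / f x x) \<star> x + lc I a v" unfolding a[symmetric] by simp
    also have "\<dots> = lc (insert j I) (a(j := f x u / f x x)) v'"
      unfolding lc using j by (simp add: lc_fun_upd)
    finally show "u \<in> range (\<lambda>a. lc (insert j I) a v')" by blast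
  next
    fix u assume "u \<in> range (\<lambda>a. lc (insert j I) a v')"
    moreover have "v' ` insert j I \<subseteq> U" using xU vU v'I by (auto simp: v'_def U'_def)
    ultimately show "u \<in> U" using lc_in_subspace[OF sub] by blast
  qed
  moreover have "g (v' i) (v' l) = 0 \<and> h (v' i) (v' l) = 0"
    if "i \<in> insert j I" "l \<in> insert j I" "i \<noteq> l" for i l
    using that I(4) orth orth' vU unfolding v'_def by auto
  moreover have "g (v' i) (v' i) \<noteq> 0 \<or> h (v' i) (v' i) \<noteq> 0" if "i \<in> insert j I" for i
    using that I(5) x0 by (auto simp: v'_def)
  ultimately show ?case using I j by (intro exI[of _ "insert j I"] exI[of _ v']) auto
qed

text \<open>Orthogonality of \<open>x\<close> to \<open>U'\<close> keeps the enlarged family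
  isotropic, and \<open>x\<close> lying outside \<open>U'\<close> keeps it independent.\<close>

lemma isotropic_dim_ge_insert:
  assumes "hermitian_form g" "hermitian_form h" "isotropic_dim_ge g h U' k"
    and "U' \<subseteq> U" "x \<in> U" "x \<notin> U'" "subspace U'" "g x x = 0" "h x x = 0"
    and "\<And>u. u \<in> U' \<Longrightarrow> g x u = 0 \<and> h x u = 0"
  shows "isotropic_dim_ge g h U (Suc k)"
proof -
  obtain I w where I: "finite I" "card I = k" "w ` I \<subseteq> U'" "indep I w" "isotropic_family g h I w"
    using assms unfolding isotropic_dim_ge_def by blast
  obtain j where j: "j \<notin> I" using I(1) ex_new_if_finite[OF infinite_UNIV_nat] by blast
  define w' where "w' = w(j := x)"
  have w'I: "w' i = w i" if "i \<in> I" for i using that j by (auto simp: w'_def)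
  have lc: "lc (insert j I) a w' = a j \<star> x + lc I a w" for a
    using lc_insert[OF I(1) j] lc_cong[of I a a w' w] w'I by (simp add: w'_def)
  have "indep (insert j I) w'"
    unfolding indep_def
  proof (intro allI impI ballI)
    fix a i assume a: "lc (insert j I) a w' = 0" and i: "i \<in> insert j I"
    have lU: "lc I a w \<in> U'" using lc_in_subspace assms(7) I(3) by blast
    have aj: "a j = 0"
    proof (rule ccontr)
      assume "a j \<noteq> 0"
      then have "x = (1 / a j) \<star> (a j \<star> x)" by simp
      also have "a j \<star> x = (- 1) \<star> lc I a w" using a unfolding lc by (simp add: add_eq_0_iff2)
      finally have "x = (1 / a j) \<star> (- 1) \<star> lc I a w" .
      then have "x \<in> U'" using lU assms(7) subspace_scale by metis
      then show False using assms by simp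
    qed
    then have "lc I a w = 0" using a unfolding lc by simp
    then show "a i = 0" using I(4) i aj unfolding indep_def by blast
  qed
  moreover have "isotropic_family g h (insert j I) w'"
  proof -
    have *: "g u x = 0 \<and> h u x = 0" if "u \<in> U'" for u
      using assms(10)[OF that] hermitian_cnj[OF assms(1), of x u] hermitian_cnj[OF assms(2), of x u] by auto
    show ?thesis using I(3,5) assms(8-10) * j unfolding isotropic_family_def w'_def by auto
  qed
  moreover have "w' ` insert j I \<subseteq> U" using I(3) assms w'I by (auto simp: w'_def)
  ultimately show ?thesis unfolding isotropic_dim_ge_def using I j
    by (intro exI[of _ "insert j I"] exI[of _ w']) auto
qed

text \<open>\<open>U'\<close> models the orthogonal complement of \<open>x\<close> modulo
  \<open>x\<close>. A form \<open>p\<close> with \<open>p x x = 0\<close> and \<open>p y x\<close>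
  nonzero takes arbitrarily negative values on the line \<open>z + \<gamma> x\<close>, where
  \<open>z\<close> is \<open>y\<close> made orthogonal to a given family in \<open>U'\<close>. Since
  \<open>x\<close> is orthogonal to the family, the whole line is, and the family gains a negative
  vector.\<close>

lemma isotropic_eigenvector_reduction:
  assumes "hermitian_form g" "hermitian_form h" "has_dim U n" "pencil_eigenvector g h U x"
    and "g x x = 0" "h x x = 0" and y: "y \<in> U" "g y x \<noteq> 0 \<or> h y x \<noteq> 0"
  obtains U' where "U' \<subseteq> U" "has_dim U' (n - 2)" "x \<notin> U'" "\<And>u. u \<in> U' \<Longrightarrow> g x u = 0 \<and> h x u = 0"
    and "\<And>c s m. neg_index_ge (pencil g h c s) U' m \<Longrightarrow> \<exists>c s. neg_index_ge (pencil g h c s) U (Suc m)"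
proof -
  obtain \<alpha> \<beta> where \<alpha>\<beta>: "\<alpha> \<noteq> 0 \<or> \<beta> \<noteq> 0" "x \<in> U" "x \<noteq> 0"
    "\<And>u. u \<in> U \<Longrightarrow> \<alpha> * g u x + \<beta> * h u x = 0"
    using assms(4) unfolding pencil_eigenvector_def by blast
  define f where "f = (if g y x \<noteq> 0 then g else h)"
  have f: "hermitian_form f" "f y x \<noteq> 0" "f x x = 0" using assms by (auto simp: f_def)
  have fxy: "f x y \<noteq> 0" using f hermitian_cnj[OF f(1), of x y] by auto
  define U1 where "U1 = {u \<in> U. f x u = 0}"
  have U1: "has_dim U1 (n - 1)"
    unfolding U1_def using has_dim_kernel[OF assms(3) hermitian_functional[OF f(1), of x] y(1) fxy] .
  have "x \<in> U1" using \<alpha>\<beta> f by (simp add: U1_def)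
  then obtain U' where U': "U' \<subseteq> U1" "has_dim U' (n - 2)" "x \<notin> U'"
    using has_dim_complement[OF U1 _ \<alpha>\<beta>(3)] by (metis diff_diff_left one_add_one)
  have orth: "g u x = 0 \<and> h u x = 0" if "u \<in> U'" for u
  proof -
    have u: "u \<in> U" "f u x = 0" using that U' hermitian_cnj[OF f(1), of x u] by (auto simp: U1_def)
    show ?thesis using \<alpha>\<beta>(1) \<alpha>\<beta>(4)[OF u(1)] \<alpha>\<beta>(4)[OF y(1)] u(2) y(2)
      by (cases "g y x = 0") (auto simp: f_def)
  qed
  then have orth': "g x u = 0 \<and> h x u = 0" if "u \<in> U'" for u
    using that hermitian_cnj[OF assms(1), of u x] hermitian_cnj[OF assms(2), of u x] by auto
  note sub = has_dim_subspace[OF assms(3)]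
  have generic: "neg_index_ge (pencil g h c s) U (Suc m)"
    if neg: "neg_index_ge (pencil g h c s) U' m" and nz: "pencil g h c s y x \<noteq> 0" for c s m
  proof -
    define p where "p = pencil g h c s"
    have p: "hermitian_form p" unfolding p_def using hermitian_pencil assms by blast
    obtain I b where I: "finite I" "card I = m" "b ` I \<subseteq> U'" "neg_orthonormal p I b"
      using neg_index_geE[OF neg[folded p_def] p has_dim_subspace[OF U'(2)]] by metis
    have bU: "b ` I \<subseteq> U" using I U' by (auto simp: U1_def)
    have pbx: "p (b i) x = 0" if "i \<in> I" for i using orth I(3) that unfolding p_def pencil_def by auto
    have pxx: "p x x = 0" using assms unfolding p_def pencil_def by simp
    define z where "z = y + lc I (\<lambda>l. p (b l) y) b"
    have pbz: "p (b i) z = 0" if "i \<in> I" for i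
      unfolding z_def using neg_orthonormal_project[OF p I(4,1) that] .
    have zU: "z \<in> U" unfolding z_def using y sub lc_in_subspace[OF sub bU] by (auto intro: subspace_add)
    have pzx: "p z x = p y x"
      unfolding z_def using p pbx by (simp add: hermitian_add_left hermitian_lc_left)
    \<comment> \<open>Chosen so that the cross terms contribute
      \<open>- 2 * (\<bar>Re (p z z)\<bar> + 1)\<close>, which outweighs
      \<open>p z z\<close>.\<close>
    define \<gamma> where "\<gamma> = - of_real (\<bar>Re (p z z)\<bar> + 1) / p y x"
    define z' where "z' = z + \<gamma> \<star> x"
    have pzz': "p z' z' = p z z + \<gamma> * p z x + cnj (\<gamma> * p z x)"
      unfolding z'_def using p pxx hermitian_cnj[OF p, of z x]
      by (simp add: hermitian_add_left hermitian_add_right hermitian_scale_left hermitian_scale_right)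
    have "\<gamma> * p z x = - of_real (\<bar>Re (p z z)\<bar> + 1)"
      unfolding pzx \<gamma>_def using nz by (simp add: p_def)
    then have "Re (p z' z') = Re (p z z) - 2 * (\<bar>Re (p z z)\<bar> + 1)" unfolding pzz' by simp
    then have "Re (p z' z') < 0" by (simp add: abs_if split: if_splits)
    moreover have "p (b i) z' = 0" if "i \<in> I" for i
      unfolding z'_def using p pbz[OF that] pbx[OF that]
      by (simp add: hermitian_add_right hermitian_scale_right)
    moreover have "z' \<in> U" unfolding z'_def using zU \<alpha>\<beta>(2) sub by (auto intro: subspace_add subspace_scale)
    ultimately show ?thesis
      using neg_index_ge_Suc[OF p I(4,1) bU sub] I(2) unfolding p_def by blast
  qed
  have "\<exists>c s. neg_index_ge (pencil g h c s) U (Suc m)"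
    if neg: "neg_index_ge (pencil g h c s) U' m" for c s m
  proof (cases "pencil g h c s y x = 0")
    case False
    then show ?thesis using generic neg by blast
  next
    case True
    txt \<open>Here \<open>x\<close> may lie in the radical, but negative definite families persist under small
      perturbations, which lead to a form of the pencil for which it does not.\<close>
    obtain c1 s1 where c1: "pencil g h c1 s1 y x \<noteq> 0"
    proof (cases "g y x = 0")
      case True
      then show ?thesis using that[of 0 1] y by (simp add: pencil_def)
    next
      case False
      then show ?thesis using that[of 1 0] by (simp add: pencil_def)
    qed
    obtain \<delta> where \<delta>: "\<delta> > 0"
      "\<And>\<epsilon>. 0 < \<epsilon> \<Longrightarrow> \<epsilon> < \<delta> \<Longrightarrow> neg_index_ge (pencil (pencil g h c s) (pencil g h c1 s1) 1 \<epsilon>) U' m"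
      using neg_index_ge_perturb[OF neg _ _ has_dim_subspace[OF U'(2)]] hermitian_pencil assms(1,2) by metis
    have "neg_index_ge (pencil (pencil g h c s) (pencil g h c1 s1) 1 (\<delta>/2)) U' m" using \<delta> by simp
    moreover have "pencil (pencil g h c s) (pencil g h c1 s1) 1 (\<delta>/2) y x \<noteq> 0"
      unfolding pencil_def[of "pencil g h c s"] using True c1 \<delta>(1) by simp
    ultimately show ?thesis unfolding pencil_pencil using generic by blast
  qed
  moreover have "U' \<subseteq> U" using U' by (auto simp: U1_def)
  ultimately show ?thesis using that U' orth' by blast
qed

end

section \<open>Hyperplanes that reduce the index\<close>

text \<open>Adding a pole \<rho> splits each term by \<open>1 / ((\<tau> - t) (\<rho> - \<tau>)) =
  (1 / (\<tau> - t) - 1 / (\<tau> - \<rho>)) / (\<rho> - t)\<close>. The induction hypothesis is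
  needed both at \<open>t\<close> and at \<rho>, hence the arbitrary \<open>t\<close>.\<close>

lemma partial_fractions:
  fixes S :: "real set"
  assumes "finite S" "S \<noteq> {}" "t \<notin> S"
  shows "(\<Sum>\<tau>\<in>S. 1 / ((\<tau> - t) * (\<Prod>\<sigma>\<in>S - {\<tau>}. \<sigma> - \<tau>))) = 1 / (\<Prod>\<sigma>\<in>S. \<sigma> - t)"
  using assms
proof (induction S arbitrary: t rule: finite_ne_induct)
  case (singleton x)
  then show ?case by simp
next
  case (insert \<rho> S)
  define Q where "Q = (\<lambda>\<tau>. \<Prod>\<sigma>\<in>S - {\<tau>}. \<sigma> - \<tau>)"
  define P where "P = (\<lambda>x. \<Prod>\<sigma>\<in>S. \<sigma> - x)"
  have nz: "\<rho> - t \<noteq> 0" "P t \<noteq> 0" "P \<rho> \<noteq> 0"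
    using insert by (auto simp: P_def)
  have summand: "1 / ((\<tau> - t) * (\<Prod>\<sigma>\<in>insert \<rho> S - {\<tau>}. \<sigma> - \<tau>)) =
      (1 / ((\<tau> - t) * Q \<tau>) - 1 / ((\<tau> - \<rho>) * Q \<tau>)) / (\<rho> - t)" if "\<tau> \<in> S" for \<tau>
  proof -
    have "insert \<rho> S - {\<tau>} = insert \<rho> (S - {\<tau>})" using that insert by auto
    then have "(\<Prod>\<sigma>\<in>insert \<rho> S - {\<tau>}. \<sigma> - \<tau>) = (\<rho> - \<tau>) * Q \<tau>"
      using insert by (simp add: Q_def)
    moreover have "\<tau> - t \<noteq> 0" "\<tau> - \<rho> \<noteq> 0" "\<rho> - \<tau> \<noteq> 0" "Q \<tau> \<noteq> 0"
      using that insert by (auto simp: Q_def)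
    ultimately show ?thesis using nz(1) by (simp add: divide_simps) (simp add: algebra_simps)
  qed
  have "(\<Sum>\<tau>\<in>S. 1 / ((\<tau> - t) * (\<Prod>\<sigma>\<in>insert \<rho> S - {\<tau>}. \<sigma> - \<tau>))) =
      ((\<Sum>\<tau>\<in>S. 1 / ((\<tau> - t) * Q \<tau>)) - (\<Sum>\<tau>\<in>S. 1 / ((\<tau> - \<rho>) * Q \<tau>))) / (\<rho> - t)"
    by (simp add: summand sum_subtractf sum_divide_distrib[symmetric])
  also have "\<dots> = (1 / P t - 1 / P \<rho>) / (\<rho> - t)"
    using insert.IH[of t] insert.IH[of \<rho>] insert by (simp add: P_def Q_def)
  finally have "(\<Sum>\<tau>\<in>insert \<rho> S. 1 / ((\<tau> - t) * (\<Prod>\<sigma>\<in>insert \<rho> S - {\<tau>}. \<sigma> - \<tau>))) =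
      1 / ((\<rho> - t) * P \<rho>) + (1 / P t - 1 / P \<rho>) / (\<rho> - t)"
    using insert by (simp add: P_def)
  also have "\<dots> = 1 / ((\<rho> - t) * P t)" using nz by (simp add: divide_simps)
  finally show ?case using insert by (simp add: P_def)
qed

text \<open>The negative factors are those with \<open>\<sigma> < t\<close>. This gives the sign of
  the rational function at a regular point and, with the pole itself removed from \<open>S\<close>,
  the sign of its coefficient at a pole.\<close>

lemma prod_diff_pos_iff:
  fixes S :: "real set"
  assumes "finite S" "t \<notin> S"
  shows "0 < (\<Prod>\<sigma>\<in>S. \<sigma> - t) \<longleftrightarrow> even (card {\<sigma> \<in> S. \<sigma> < t})"
  using assms
proof (induction S rule: finite_induct)
  case (insert x S)
  have nz: "(\<Prod>\<sigma>\<in>S. \<sigma> - t) \<noteq> 0" using insert by auto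
  have "{\<sigma> \<in> insert x S. \<sigma> < t} = (if x < t then insert x {\<sigma> \<in> S. \<sigma> < t} else {\<sigma> \<in> S. \<sigma> < t})"
    by auto
  then have "card {\<sigma> \<in> insert x S. \<sigma> < t} = (if x < t then Suc (card {\<sigma> \<in> S. \<sigma> < t}) else card {\<sigma> \<in> S. \<sigma> < t})"
    using insert by simp
  moreover have "(\<Prod>\<sigma>\<in>S. \<sigma> - t) < 0 \<longleftrightarrow> odd (card {\<sigma> \<in> S. \<sigma> < t})"
    using insert nz by (metis insertCI linorder_neqE_linordered_idom order_less_asym)
  ultimately show ?case using insert by (auto simp: zero_less_mult_iff)
qed simp

text \<open>
  Follow the step function \<open>d - (\<Sum>\<tau> < t. J \<tau>)\<close>, which starts at its upper bound \<open>d\<close>. The set \<open>S\<close> collects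
  the jumps at which it reaches \<open>k\<close> when the last extreme value visited was \<open>d\<close>, or conversely.
\<close>

lemma alternating_jump_set:
  fixes T :: "real set" and J :: "real \<Rightarrow> int"
  assumes "finite T" "k < d"
    and "\<And>t. k \<le> d - (\<Sum>\<tau>\<in>{\<tau> \<in> T. \<tau> < t}. J \<tau>) \<and> d - (\<Sum>\<tau>\<in>{\<tau> \<in> T. \<tau> < t}. J \<tau>) \<le> d"
  shows "\<exists>S\<subseteq>T. (\<forall>t. (d - (\<Sum>\<tau>\<in>{\<tau> \<in> T. \<tau> < t}. J \<tau>) = d \<longrightarrow> even (card {\<sigma> \<in> S. \<sigma> < t})) \<and>
      (d - (\<Sum>\<tau>\<in>{\<tau> \<in> T. \<tau> < t}. J \<tau>) = k \<longrightarrow> odd (card {\<sigma> \<in> S. \<sigma> < t}))) \<and>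
      (\<forall>\<tau>\<in>S. even (card {\<sigma> \<in> S. \<sigma> < \<tau>}) \<longleftrightarrow> 0 < J \<tau>)"
  using assms(1,3)
proof (induction T rule: finite_linorder_max_induct)
  case empty
  then show ?case using assms(2) by (intro exI[of _ "{}"]) auto
next
  case (insert b A)
  define N where "N = (\<lambda>t. d - (\<Sum>\<tau>\<in>{\<tau> \<in> A. \<tau> < t}. J \<tau>))"
  define N' where "N' = (\<lambda>t. d - (\<Sum>\<tau>\<in>{\<tau> \<in> insert b A. \<tau> < t}. J \<tau>))"
  have N'_le: "N' t = N t" if "t \<le> b" for t
  proof -
    have "{\<tau> \<in> insert b A. \<tau> < t} = {\<tau> \<in> A. \<tau> < t}" using that by auto
    then show ?thesis by (simp add: N_def N'_def)
  qed
  have N_gt: "N t = N b" if "b < t" for t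
  proof -
    have "{\<tau> \<in> A. \<tau> < t} = {\<tau> \<in> A. \<tau> < b}" using that insert.hyps by force
    then show ?thesis by (simp add: N_def)
  qed
  have N'_gt: "N' t = N b - J b" if "b < t" for t
  proof -
    have "{\<tau> \<in> insert b A. \<tau> < t} = insert b {\<tau> \<in> A. \<tau> < t}" using that by auto
    moreover have "b \<notin> A" using insert.hyps by auto
    ultimately have "N' t = N t - J b" using insert.hyps by (simp add: N_def N'_def)
    then show ?thesis using N_gt that by simp
  qed
  have bound': "k \<le> N' t" "N' t \<le> d" for t using insert.prems[of t] by (auto simp: N'_def)
  have bound: "k \<le> N t \<and> N t \<le> d" for t
  proof (cases "t \<le> b")
    case True
    then show ?thesis using bound'[of t] N'_le by simp
  next
    case False
    then show ?thesis using bound'[of b] N'_le[of b] N_gt[of t] by simp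
  qed
  obtain S where S: "S \<subseteq> A" "\<And>t. N t = d \<Longrightarrow> even (card {\<sigma> \<in> S. \<sigma> < t})"
    "\<And>t. N t = k \<Longrightarrow> odd (card {\<sigma> \<in> S. \<sigma> < t})"
    "\<And>\<tau>. \<tau> \<in> S \<Longrightarrow> even (card {\<sigma> \<in> S. \<sigma> < \<tau>}) \<longleftrightarrow> 0 < J \<tau>"
    using insert.IH bound unfolding N_def by blast
  have Sb: "\<And>\<sigma>. \<sigma> \<in> S \<Longrightarrow> \<sigma> < b" "finite S"
    using S(1) insert.hyps finite_subset by auto
  have all: "{\<sigma> \<in> S. \<sigma> < t} = S" if "b \<le> t" for t using Sb that by force
  have bS: "b \<notin> S" using Sb by auto
  \<comment> \<open>The parity of \<open>card S\<close> records the last extreme value visited, even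
    for \<open>d\<close> and odd for \<open>k\<close>. The jump \<open>b\<close> is added exactly
    when the value after it is the opposite extreme.\<close>
  define flip where "flip \<longleftrightarrow> (N b - J b = d \<and> odd (card S)) \<or> (N b - J b = k \<and> even (card S))"
  define S' where "S' = (if flip then insert b S else S)"
  have low: "{\<sigma> \<in> S'. \<sigma> < t} = {\<sigma> \<in> S. \<sigma> < t}" if "t \<le> b" for t
    using that by (auto simp: S'_def)
  have high: "{\<sigma> \<in> S'. \<sigma> < t} = S'" if "b < t" for t
    using that Sb by (force simp: S'_def split: if_splits)
  have cS': "card S' = (if flip then Suc (card S) else card S)"
    using Sb bS by (simp add: S'_def)
  have parity: "(N' t = d \<longrightarrow> even (card {\<sigma> \<in> S'. \<sigma> < t})) \<and> (N' t = k \<longrightarrow> odd (card {\<sigma> \<in> S'. \<sigma> < t}))" for t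
  proof (cases "t \<le> b")
    case True
    then show ?thesis using S(2,3)[of t] N'_le low by simp
  next
    case False
    then have t: "b < t" by simp
    show ?thesis unfolding high[OF t] N'_gt[OF t] cS' using assms(2) by (auto simp: flip_def)
  qed
  have "even (card {\<sigma> \<in> S'. \<sigma> < \<tau>}) \<longleftrightarrow> 0 < J \<tau>" if "\<tau> \<in> S'" for \<tau>
  proof (cases "\<tau> \<in> S")
    case True
    then show ?thesis using S(4)[OF True] Sb(1)[OF True] low[of \<tau>] by simp
  next
    case False
    then have \<tau>: "\<tau> = b" and flip using that by (auto simp: S'_def split: if_splits)
    have "card {\<sigma> \<in> S'. \<sigma> < b} = card S" using low[of b] all[of b] by simp
    \<comment> \<open>With odd parity the value rises to its maximum \<open>d\<close>, or was there
      already, so the jump is not positive. With even parity it falls to \<open>k\<close>, and it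
      was not \<open>k\<close> before the jump.\<close>
    moreover have "odd (card S) \<Longrightarrow> \<not> 0 < J b" using \<open>flip\<close> bound[of b] by (auto simp: flip_def)
    moreover have "0 < J b" if "even (card S)"
    proof -
      have "N b - J b = k" using \<open>flip\<close> that by (auto simp: flip_def)
      moreover have "N b \<noteq> k" using S(3)[of b] all[of b] that by auto
      ultimately show ?thesis using bound[of b] by linarith
    qed
    ultimately show ?thesis using \<tau> by auto
  qed
  moreover have "S' \<subseteq> insert b A" using S(1) by (auto simp: S'_def)
  ultimately show ?case using parity unfolding N'_def by (intro exI[of _ S']) blast
qed

text \<open>Sums over \<open>\<tau> < t\<close> are left-continuous in \<open>t\<close>. Thus the
  value of the step function at a jump is also its value at a point off \<open>T\<close>, where it
  counts eigenvalues of a nondegenerate form.\<close>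

lemma finite_gap_below:
  fixes T :: "real set"
  assumes "finite T" obtains t' where "t' < t" "\<And>\<tau>. \<tau> \<in> T \<Longrightarrow> \<tau> < t \<Longrightarrow> \<tau> < t'"
proof -
  have "\<exists>t'<t. \<forall>\<tau>\<in>T. \<tau> < t \<longrightarrow> \<tau> < t'"
    using assms
  proof (induction T rule: finite_induct)
    case empty
    show ?case using lt_ex[of t] by auto
  next
    case (insert x T)
    then obtain t' where t': "t' < t" "\<forall>\<tau>\<in>T. \<tau> < t \<longrightarrow> \<tau> < t'" by blast
    show ?case
    proof (cases "x < t")
      case True
      then obtain y where "max x t' < y" "y < t" using dense[of "max x t'" t] t' by auto
      then show ?thesis using t'(2) by (intro exI[of _ y]) auto
    next
      case False
      then show ?thesis using t' by (intro exI[of _ t']) auto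
    qed
  qed
  then show ?thesis using that by blast
qed

section \<open>Index of diagonal forms and construction of the hyperplane\<close>

context complex_vector_space
begin

lemma neg_index_ge_scale:
  assumes "neg_index_ge (pencil g h (r * c) (r * s)) U m" "r > 0"
  shows "neg_index_ge (pencil g h c s) U m"
proof -
  have "Re (pencil g h (r * c) (r * s) u u) = r * Re (pencil g h c s u u)" for u
    by (simp add: pencil_def algebra_simps)
  then show ?thesis using assms unfolding neg_index_ge_def neg_def_family_def
    by (simp add: mult_less_0_iff)
qed

text \<open>The direction \<open>(1, s1)\<close> annihilates no point of \<open>Z\<close>. Hence,
  when the form moves in this direction, each point of \<open>Z\<close> excludes only one
  \<epsilon>, whereas a whole interval of \<epsilon> preserves the index.\<close>

lemma neg_index_ge_generic:
  assumes "neg_index_ge (pencil g h c s) U m" "hermitian_form g" "hermitian_form h" "subspace U"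
    and Z: "finite Z" "(0, 0) \<notin> Z"
  obtains c' s' where "neg_index_ge (pencil g h c' s') U m" "\<And>p q. (p, q) \<in> Z \<Longrightarrow> c' * p + s' * q \<noteq> 0"
proof -
  have "finite ((\<lambda>(p, q). - p / q) ` Z)" using Z by simp
  then obtain s1 where s1: "s1 \<notin> (\<lambda>(p, q). - p / q) ` Z"
    using ex_new_if_finite[OF infinite_UNIV_char_0] by blast
  have s1: "p + s1 * q \<noteq> 0" if "(p, q) \<in> Z" for p q
  proof
    assume *: "p + s1 * q = 0"
    then have "q \<noteq> 0" using that Z(2) by auto
    then have "s1 = - p / q" using * by (simp add: field_simps eq_neg_iff_add_eq_0)
    then show False using s1 that by force
  qed
  obtain \<delta> where \<delta>: "\<delta> > 0"
    "\<And>\<epsilon>. 0 < \<epsilon> \<Longrightarrow> \<epsilon> < \<delta> \<Longrightarrow> neg_index_ge (pencil (pencil g h c s) (pencil g h 1 s1) 1 \<epsilon>) U m"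
    using neg_index_ge_perturb[OF assms(1) _ _ assms(4)] hermitian_pencil assms(2,3) by metis
  define bad where "bad = (\<lambda>(p, q). - (c * p + s * q) / (p + s1 * q)) ` Z"
  have "infinite ({0<..<\<delta>} - bad)" using \<delta>(1) Z(1) by (simp add: bad_def infinite_Ioo)
  then have "{0<..<\<delta>} - bad \<noteq> {}" by (rule infinite_imp_nonempty)
  then obtain \<epsilon> where "\<epsilon> \<in> {0<..<\<delta>} - bad" by blast
  then have \<epsilon>: "0 < \<epsilon>" "\<epsilon> < \<delta>" "\<epsilon> \<notin> bad" by simp_all
  have "(c + \<epsilon>) * p + (s + \<epsilon> * s1) * q \<noteq> 0" if "(p, q) \<in> Z" for p q
  proof
    assume "(c + \<epsilon>) * p + (s + \<epsilon> * s1) * q = 0"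
    then have "\<epsilon> * (p + s1 * q) = - (c * p + s * q)" by (simp add: algebra_simps)
    then have "\<epsilon> = - (c * p + s * q) / (p + s1 * q)" using s1[OF that] nonzero_eq_divide_eq by blast
    then show False using \<epsilon>(3) that unfolding bad_def by force
  qed
  moreover have "neg_index_ge (pencil g h (c + \<epsilon>) (s + \<epsilon> * s1)) U m"
    using \<delta>(2)[OF \<epsilon>(1,2)] unfolding pencil_pencil by simp
  ultimately show ?thesis using that by blast
qed

lemma diagonal_form:
  assumes "hermitian_form f" "finite I" "\<forall>i\<in>I. \<forall>j\<in>I. i \<noteq> j \<longrightarrow> f (v i) (v j) = 0"
  shows "i \<in> I \<Longrightarrow> K \<subseteq> I \<Longrightarrow> f (v i) (lc K a v) = (if i \<in> K then a i * f (v i) (v i) else 0)"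
    and "K \<subseteq> I \<Longrightarrow> Re (f (lc K a v) (lc K a v)) = (\<Sum>i\<in>K. (cmod (a i))\<^sup>2 * Re (f (v i) (v i)))"
proof -
  have *: "f (v i) (lc K a v) = (if i \<in> K then a i * f (v i) (v i) else 0)" if "i \<in> I" "K \<subseteq> I" for i K
  proof -
    have "f (v i) (lc K a v) = (\<Sum>j\<in>K. if i = j then a i * f (v i) (v i) else 0)"
      unfolding hermitian_lc_right[OF assms(1)] using assms(3) that by (intro sum.cong) auto
    then show ?thesis using finite_subset[OF that(2) assms(2)] by simp
  qed
  show "i \<in> I \<Longrightarrow> K \<subseteq> I \<Longrightarrow> f (v i) (lc K a v) = (if i \<in> K then a i * f (v i) (v i) else 0)"
    using * .
  assume K: "K \<subseteq> I"
  have "f (lc K a v) (lc K a v) = (\<Sum>i\<in>K. cnj (a i) * (a i * f (v i) (v i)))"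
    unfolding hermitian_lc_left[OF assms(1)] using *[OF _ K] K by (intro sum.cong refl) auto
  also have "\<dots> = (\<Sum>i\<in>K. of_real ((cmod (a i))\<^sup>2) * f (v i) (v i))"
    by (intro sum.cong refl) (simp add: complex_norm_square[symmetric] mult.assoc[symmetric] mult.commute[of "cnj _"] del: of_real_power)
  finally show "Re (f (lc K a v) (lc K a v)) = (\<Sum>i\<in>K. (cmod (a i))\<^sup>2 * Re (f (v i) (v i)))"
    by (simp del: of_real_power)
qed

text \<open>Sylvester's law of inertia. If a negative definite family had more members than
  \<open>K\<close>, the equations \<open>f (v j) u = 0\<close> for \<open>j\<close> in
  \<open>K\<close> would have a nontrivial solution in its span; such a \<open>u\<close> has no
  component along \<open>K\<close>, so its value is nonnegative.\<close>

lemma neg_index_diagonal: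
  assumes f: "hermitian_form f" and I: "finite I"
    and orth: "\<forall>i\<in>I. \<forall>j\<in>I. i \<noteq> j \<longrightarrow> f (v i) (v j) = 0"
    and U: "U = range (\<lambda>a. lc I a v)"
  shows "neg_index_ge f U (card {i \<in> I. Re (f (v i) (v i)) < 0})"
    and "neg_index_ge f U m \<Longrightarrow> m \<le> card {i \<in> I. Re (f (v i) (v i)) < 0}"
proof -
  note diag = diagonal_form[OF f I orth]
  define K where "K = {i \<in> I. Re (f (v i) (v i)) < 0}"
  have K: "K \<subseteq> I" "finite K" using I by (auto simp: K_def)
  have "neg_def_family f K v"
    unfolding neg_def_family_def
  proof (intro allI impI)
    fix a :: "nat \<Rightarrow> complex" assume "\<exists>i\<in>K. a i \<noteq> 0"
    then obtain i where i: "i \<in> K" "a i \<noteq> 0" by blast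
    have "0 < (\<Sum>i\<in>K. - ((cmod (a i))\<^sup>2 * Re (f (v i) (v i))))"
      by (rule sum_pos2[OF K(2) i(1)])
        (use i in \<open>auto simp: K_def mult_less_0_iff mult_le_0_iff\<close>)
    then show "Re (f (lc K a v) (lc K a v)) < 0" unfolding diag(2)[OF K(1)] by (simp add: sum_negf)
  qed
  moreover have "v i \<in> U" if "i \<in> K" for i
    unfolding U using lc_single[OF I, of i v, symmetric] K(1) that by (metis rangeI subsetD)
  ultimately show "neg_index_ge f U (card {i \<in> I. Re (f (v i) (v i)) < 0})"
    unfolding neg_index_ge_def K_def[symmetric]
    using K(2) by (intro exI[of _ K] exI[of _ v]) auto
  assume "neg_index_ge f U m"
  then obtain L b where L: "finite L" "card L = m" "b ` L \<subseteq> U" "neg_def_family f L b"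
    unfolding neg_index_ge_def by blast
  show "m \<le> card {i \<in> I. Re (f (v i) (v i)) < 0}"
  proof (rule ccontr)
    assume "\<not> ?thesis"
    then have "card K < card L" using L by (simp add: K_def)
    then obtain a where a: "\<exists>i\<in>L. a i \<noteq> 0" "\<And>j. j \<in> K \<Longrightarrow> (\<Sum>i\<in>L. a i * f (v j) (b i)) = 0"
      using homogeneous_system[OF K(2) L(1), of "\<lambda>j i. f (v j) (b i)"] by blast
    have "subspace U" unfolding U by (rule subspace_range_lc)
    then have "lc L a b \<in> U" using lc_in_subspace L(3) by blast
    then obtain c where c: "lc L a b = lc I c v" using U by blast
    have cK: "c j = 0" if "j \<in> K" for j
    proof -
      have "f (v j) (lc L a b) = 0" using a(2)[OF that] by (simp add: hermitian_lc_right[OF f])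
      then have "c j * f (v j) (v j) = 0" unfolding c using diag(1)[of j I c] that K by auto
      then show ?thesis using that by (auto simp: K_def)
    qed
    have "0 \<le> (cmod (c i))\<^sup>2 * Re (f (v i) (v i))" if "i \<in> I" for i
      using cK[of i] that by (cases "i \<in> K") (auto simp: K_def)
    then have "0 \<le> (\<Sum>i\<in>I. (cmod (c i))\<^sup>2 * Re (f (v i) (v i)))"
      by (rule sum_nonneg)
    then have "0 \<le> Re (f (lc L a b) (lc L a b))" unfolding c diag(2)[OF order.refl] .
    then show False using L(4) a(1) unfolding neg_def_family_def by force
  qed
qed


text \<open>The pencil is normalized: all eigenvalues are finite and \<open>- h\<close> attains the
  index \<open>d\<close>. The hypothesis \<open>sign\<close> excludes cancellation among
  eigenvectors with the same eigenvalue, so each eigenvalue yields a nonzero jump whose sign is that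
  of \<open>h\<close> there.\<close>

lemma reducing_hyperplane:
  assumes g: "hermitian_form g" and h: "hermitian_form h"
    and I: "finite I" "I \<noteq> {}" and U: "U = range (\<lambda>a. lc I a v)" "has_dim U n" "card I = n"
    and orth_g: "\<forall>i\<in>I. \<forall>j\<in>I. i \<noteq> j \<longrightarrow> g (v i) (v j) = 0"
    and orth_h: "\<forall>i\<in>I. \<forall>j\<in>I. i \<noteq> j \<longrightarrow> h (v i) (v j) = 0"
    and nz: "\<And>i. i \<in> I \<Longrightarrow> Re (h (v i) (v i)) \<noteq> 0"
    and sign: "\<And>i j. i \<in> I \<Longrightarrow> j \<in> I \<Longrightarrow>
      Re (g (v i) (v i)) / Re (h (v i) (v i)) = Re (g (v j) (v j)) / Re (h (v j) (v j)) \<Longrightarrow>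
      0 < Re (h (v i) (v i)) \<Longrightarrow> 0 < Re (h (v j) (v j))"
    and bound: "\<And>c s m. neg_index_ge (pencil g h c s) U m \<Longrightarrow> m \<le> d"
    and attained: "neg_index_ge (pencil g h 0 (- 1)) U d"
  shows "\<exists>W\<subseteq>U. has_dim W (n - 1) \<and> (\<forall>c s m. neg_index_ge (pencil g h c s) W m \<longrightarrow> m < d)"
proof -
  define hi where "hi = (\<lambda>i. Re (h (v i) (v i)))"
  define tt where "tt = (\<lambda>i. Re (g (v i) (v i)) / hi i)"
  define T where "T = tt ` I"
  have T: "finite T" "T \<noteq> {}" using I by (auto simp: T_def)
  have hi: "hi i \<noteq> 0" if "i \<in> I" for i using nz that by (simp add: hi_def)
  have hii: "h (v i) (v i) = of_real (hi i)" for i unfolding hi_def by (rule hermitian_real[OF h])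
  have gii: "g (v i) (v i) = of_real (tt i * hi i)" if "i \<in> I" for i
    using hermitian_real[OF g, of "v i"] hi[OF that] by (simp add: tt_def)
  have sign': "0 < hi i \<longleftrightarrow> 0 < hi j" if "i \<in> I" "j \<in> I" "tt i = tt j" for i j
    using sign[of i j] sign[of j i] that by (auto simp: hi_def tt_def)
  note herm = hermitian_pencil[OF g h]
  have orth: "\<forall>i\<in>I. \<forall>j\<in>I. i \<noteq> j \<longrightarrow> pencil g h c s (v i) (v j) = 0" for c s
    using orth_g orth_h by (simp add: pencil_def)
  note index = neg_index_diagonal[OF herm I(1) orth U(1)]
  have pii: "Re (pencil g h c s (v i) (v i)) = hi i * (c * tt i + s)" if "i \<in> I" for c s i
    using gii[OF that] hii[of i] by (simp add: pencil_def algebra_simps)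
  \<comment> \<open>The cardinalities of these sets are the negative and the positive index of
    \<open>g - t h\<close>.\<close>
  define neg pos where "neg = (\<lambda>t. {i \<in> I. hi i * (tt i - t) < 0})"
    and "pos = (\<lambda>t. {i \<in> I. 0 < hi i * (tt i - t)})"
  have neg_alt: "neg t = {i \<in> I. Re (pencil g h 1 (- t) (v i) (v i)) < 0}" for t
    unfolding neg_def using pii by auto
  have pos_alt: "pos t = {i \<in> I. Re (pencil g h (- 1) t (v i) (v i)) < 0}" for t
    unfolding pos_def using pii by (auto simp: algebra_simps)
  have neg_le: "card (neg t) \<le> d" for t using bound[OF index(1)] by (simp add: neg_alt)
  have pos_le: "card (pos t) \<le> d" for t using bound[OF index(1)] by (simp add: pos_alt)
  have pos_neg: "card (pos t) + card (neg t) = n" if "t \<notin> T" for t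
  proof -
    have "pos t \<union> neg t = I" "pos t \<inter> neg t = {}"
      using that hi by (auto simp: pos_def neg_def T_def linorder_neq_iff mult_less_0_iff zero_less_mult_iff)
    then show ?thesis using I(1) U(3) by (metis card_Un_disjoint finite_Un)
  qed
  have pos_h: "{i \<in> I. Re (pencil g h 0 (- 1) (v i) (v i)) < 0} = {i \<in> I. 0 < hi i}"
    using pii by auto
  \<comment> \<open>To the left of all eigenvalues, \<open>pos t\<close> consists of the indices
    with positive \<open>hi\<close>. So the step function \<open>N\<close> below starts at its
    maximum \<open>d\<close>.\<close>
  have d: "card {i \<in> I. 0 < hi i} = d"
    using index(2)[OF attained] bound[OF index(1)[of 0 "- 1"]] unfolding pos_h by simp
  define sg where "sg = (\<lambda>i. if 0 < hi i then 1 else - 1 :: int)"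
  \<comment> \<open>When \<open>t\<close> passes \<tau> upwards, the indices with positive
    \<open>hi\<close> leave \<open>pos t\<close> and those with negative \<open>hi\<close> enter it,
    so the positive index changes by \<open>- J \<tau>\<close>.\<close>
  define J where "J = (\<lambda>\<tau>. \<Sum>i\<in>{i \<in> I. tt i = \<tau>}. sg i)"
  define N where "N = (\<lambda>t. int d - (\<Sum>\<tau>\<in>{\<tau> \<in> T. \<tau> < t}. J \<tau>))"
  have N_alt: "N t = int d - (\<Sum>i\<in>{i \<in> I. tt i < t}. sg i)" for t
  proof -
    have "(\<Sum>i\<in>{i \<in> I. tt i < t}. sg i) = (\<Sum>\<tau>\<in>{\<tau> \<in> T. \<tau> < t}. \<Sum>i\<in>{i \<in> {i \<in> I. tt i < t}. tt i = \<tau>}. sg i)"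
      by (rule sum.group[symmetric]) (use I T in \<open>auto simp: T_def\<close>)
    also have "\<dots> = (\<Sum>\<tau>\<in>{\<tau> \<in> T. \<tau> < t}. J \<tau>)"
      unfolding J_def by (intro sum.cong) auto
    finally show ?thesis by (simp add: N_def)
  qed
  have N_pos: "N t = int (card (pos t))" if t: "t \<notin> T" for t
  proof -
    have "int d = (\<Sum>i\<in>I. if 0 < hi i then 1 else 0)"
      unfolding d[symmetric] using I(1) by (simp add: sum.inter_filter[symmetric])
    moreover have "(\<Sum>i\<in>{i \<in> I. tt i < t}. sg i) = (\<Sum>i\<in>I. if tt i < t then sg i else 0)"
      using I(1) by (simp add: sum.inter_filter)
    moreover have "int (card (pos t)) = (\<Sum>i\<in>I. if 0 < hi i * (tt i - t) then 1 else 0)"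
      unfolding pos_def using I(1) by (simp add: sum.inter_filter[symmetric])
    moreover have "(if 0 < hi i then 1 else 0) - (if tt i < t then sg i else 0) =
        (if 0 < hi i * (tt i - t) then 1 else (0::int))" if "i \<in> I" for i
    proof -
      have "tt i \<noteq> t" using that t by (auto simp: T_def)
      then show ?thesis using hi[OF that] by (auto simp: sg_def zero_less_mult_iff)
    qed
    ultimately show ?thesis unfolding N_alt by (simp add: sum_subtractf[symmetric])
  qed
  \<comment> \<open>The lower extreme of \<open>N\<close>: the positive index is
    \<open>n - d\<close> exactly when the negative index is \<open>d\<close>.\<close>
  define k where "k = int n - int d"
  have N_bounds: "k \<le> N t \<and> N t \<le> int d" for t
  proof -
    obtain t' where t': "t' < t" "\<And>\<tau>. \<tau> \<in> T \<Longrightarrow> \<tau> < t \<Longrightarrow> \<tau> < t'"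
      using finite_gap_below[OF T(1)] by blast
    have "t' \<notin> T" using t' by blast
    have "{\<tau> \<in> T. \<tau> < t} = {\<tau> \<in> T. \<tau> < t'}" using t' by force
    then have "N t = int (card (pos t'))" using N_pos[OF \<open>t' \<notin> T\<close>] by (simp add: N_def)
    then show ?thesis using pos_neg[OF \<open>t' \<notin> T\<close>] neg_le[of t'] pos_le[of t'] by (simp add: k_def)
  qed
  have J_sign: "J (tt i) \<noteq> 0 \<and> (0 < J (tt i) \<longleftrightarrow> 0 < hi i)" if "i \<in> I" for i
  proof -
    have "J (tt i) = (\<Sum>j\<in>{j \<in> I. tt j = tt i}. sg i)"
      unfolding J_def
    proof (intro sum.cong refl)
      fix j assume "j \<in> {j \<in> I. tt j = tt i}"
      then show "sg j = sg i" using sign'[of j i] that by (simp add: sg_def)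
    qed
    then have "J (tt i) = int (card {j \<in> I. tt j = tt i}) * sg i" by simp
    moreover have "0 < card {j \<in> I. tt j = tt i}" using that I(1) by (auto simp: card_gt_0_iff)
    ultimately show ?thesis by (auto simp: sg_def)
  qed
  \<comment> \<open>Otherwise \<open>N\<close> would be constant, although the jump at the largest
    eigenvalue is nonzero.\<close>
  have "k < int d"
  proof (rule ccontr)
    assume "\<not> k < int d"
    then have const: "N t = int d" for t using N_bounds[of t] by linarith
    define \<tau> where "\<tau> = Max T"
    have \<tau>: "\<tau> \<in> T" "\<And>\<sigma>. \<sigma> \<in> T \<Longrightarrow> \<sigma> \<le> \<tau>" using T by (auto simp: \<tau>_def)
    then have "{\<sigma> \<in> T. \<sigma> < \<tau> + 1} = insert \<tau> {\<sigma> \<in> T. \<sigma> < \<tau>}" by force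
    then have "N (\<tau> + 1) = N \<tau> - J \<tau>" using T(1) by (simp add: N_def)
    then show False using const J_sign \<tau>(1) by (auto simp: T_def)
  qed
  from alternating_jump_set[OF T(1) this, of J] N_bounds obtain S where "S \<subseteq> T"
    and S: "\<And>t. N t = int d \<Longrightarrow> even (card {\<sigma> \<in> S. \<sigma> < t})" "\<And>t. N t = k \<Longrightarrow> odd (card {\<sigma> \<in> S. \<sigma> < t})"
    and SJ: "\<And>\<tau>. \<tau> \<in> S \<Longrightarrow> even (card {\<sigma> \<in> S. \<sigma> < \<tau>}) \<longleftrightarrow> 0 < J \<tau>"
    unfolding N_def by blast
  have fS: "finite S" using \<open>S \<subseteq> T\<close> T finite_subset by blast
  \<comment> \<open>Beyond the last eigenvalue the negative index is \<open>d\<close>, so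
    \<open>N\<close> has reached \<open>k\<close> and the parity of \<open>S\<close> is odd.\<close>
  have "S \<noteq> {}"
  proof -
    define t where "t = Max T + 1"
    have "\<And>\<sigma>. \<sigma> \<in> T \<Longrightarrow> \<sigma> < t" using T by (auto simp: t_def intro: le_less_trans[OF Max_ge])
    then have t: "t \<notin> T" "\<And>i. i \<in> I \<Longrightarrow> tt i < t" by (auto simp: T_def)
    have "hi i * (tt i - t) < 0 \<longleftrightarrow> 0 < hi i" if "i \<in> I" for i
      using t(2)[OF that] by (simp add: mult_less_0_iff)
    then have "neg t = {i \<in> I. 0 < hi i}" unfolding neg_def by blast
    then have "N t = k" using N_pos[OF t(1)] pos_neg[OF t(1)] d by (simp add: k_def)
    then show ?thesis using S(2) by fastforce
  qed
  \<comment> \<open>One eigenvector for each pole is enough; the functional vanishes on the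
    remaining basis vectors.\<close>
  obtain K where K: "K \<subseteq> I" "inj_on tt K" "tt ` K = S"
    using \<open>S \<subseteq> T\<close> unfolding T_def by (metis subset_image_inj)
  have fK: "finite K" using K I finite_subset by blast
  \<comment> \<open>The partial fraction coefficient at \<tau>. Alternation of the jumps in
    \<open>S\<close> gives it the sign of \<open>hi\<close>, so the weights \<omega> below are
    square roots of positive numbers.\<close>
  define C where "C = (\<lambda>\<tau>. 1 / (\<Prod>\<sigma>\<in>S - {\<tau>}. \<sigma> - \<tau>))"
  have Chi: "0 < C (tt i) / hi i" if "i \<in> K" for i
  proof -
    have "{\<sigma> \<in> S - {tt i}. \<sigma> < tt i} = {\<sigma> \<in> S. \<sigma> < tt i}" by auto
    then have "0 < (\<Prod>\<sigma>\<in>S - {tt i}. \<sigma> - tt i) \<longleftrightarrow> even (card {\<sigma> \<in> S. \<sigma> < tt i})"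
      using prod_diff_pos_iff[of "S - {tt i}" "tt i"] fS by simp
    also have "\<dots> \<longleftrightarrow> 0 < hi i" using SJ[of "tt i"] J_sign[of i] K that by auto
    finally have "0 < (\<Prod>\<sigma>\<in>S - {tt i}. \<sigma> - tt i) \<longleftrightarrow> 0 < hi i" .
    moreover have "(\<Prod>\<sigma>\<in>S - {tt i}. \<sigma> - tt i) \<noteq> 0" using fS by auto
    moreover have "hi i \<noteq> 0" using hi K(1) that by blast
    ultimately have "0 < (\<Prod>\<sigma>\<in>S - {tt i}. \<sigma> - tt i) * hi i"
      by (meson linorder_neqE_linordered_idom mult_neg_neg mult_pos_pos)
    then show ?thesis by (simp add: C_def)
  qed
  define \<omega> where "\<omega> = (\<lambda>i. sqrt (C (tt i) / hi i))"
  have \<omega>: "\<omega> i \<noteq> 0" "\<omega> i * \<omega> i * hi i = C (tt i)" if "i \<in> K" for i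
  proof -
    have "hi i \<noteq> 0" using hi K(1) that by blast
    moreover have "\<omega> i * \<omega> i = C (tt i) / hi i"
      unfolding \<omega>_def using less_imp_le[OF Chi[OF that]] by (rule real_sqrt_mult_self[THEN trans, OF abs_of_nonneg])
    ultimately show "\<omega> i * \<omega> i * hi i = C (tt i)" by simp
    show "\<omega> i \<noteq> 0" unfolding \<omega>_def using real_sqrt_gt_zero[OF Chi[OF that]] by linarith
  qed
  \<comment> \<open>the weights make \<open>\<phi>\<close>, represented as \<open>p y\<close> below, take the value \<open>1 / (\<Prod>\<sigma>\<in>S. \<sigma> - t)\<close> at \<open>y\<close>\<close>
  define \<phi> where "\<phi> = (\<lambda>u. \<Sum>i\<in>K. of_real (\<omega> i) * h (v i) u)"
  have \<phi>: "functional \<phi>"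
    unfolding functional_def \<phi>_def
    by (simp add: hermitian_add_right[OF h] hermitian_scale_right[OF h] distrib_left sum.distrib
        sum_distrib_left mult.left_commute)
  have vU: "v i \<in> U" if "i \<in> I" for i
    unfolding U using lc_single[OF I(1) that, of v] by (metis rangeI)
  obtain i0 where i0: "i0 \<in> K" using K(3) \<open>S \<noteq> {}\<close> by auto
  have "\<phi> (v i0) = (\<Sum>i\<in>K. if i = i0 then of_real (\<omega> i0 * hi i0) else 0)"
    unfolding \<phi>_def using orth_h K(1) i0 by (intro sum.cong refl) (auto simp: hii)
  then have "\<phi> (v i0) \<noteq> 0" using fK i0 \<omega>(1)[OF i0] hi[of i0] K(1) by auto
  define W where "W = {u \<in> U. \<phi> u = 0}"
  have W: "has_dim W (n - 1)"
    unfolding W_def using has_dim_kernel[OF U(2) \<phi> _ \<open>\<phi> (v i0) \<noteq> 0\<close>] vU i0 K(1) by blast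
  note subU = has_dim_subspace[OF U(2)] and subW = has_dim_subspace[OF W]
  have "m < d" if negW: "neg_index_ge (pencil g h c s) W m" for c s m
  proof -
    \<comment> \<open>Avoiding \<open>(1, 0)\<close> makes the coefficient of \<open>g\<close>
      nonzero; avoiding \<open>(\<tau>, 1)\<close> keeps the parameter \<open>t\<close> of the
      perturbed form off the eigenvalue \<tau>.\<close>
    define Z :: "(real \<times> real) set" where "Z = insert (1, 0) ((\<lambda>\<tau>. (\<tau>, 1)) ` T)"
    have Z: "finite Z" "(0, 0) \<notin> Z" using T(1) by (auto simp: Z_def)
    obtain c' s' where cs: "neg_index_ge (pencil g h c' s') W m"
      "\<And>p q. (p, q) \<in> Z \<Longrightarrow> c' * p + s' * q \<noteq> 0"
      by (rule neg_index_ge_generic[OF negW g h subW Z]) (rule that; blast)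
    have c': "c' \<noteq> 0" using cs(2)[of 1 0] by (simp add: Z_def)
    define t where "t = - s' / c'"
    have t: "t \<notin> T"
    proof
      assume "t \<in> T"
      then have "c' * t + s' * 1 \<noteq> 0" using cs(2)[of t 1] by (auto simp: Z_def)
      then show False using c' by (simp add: t_def)
    qed
    define \<epsilon> :: real where "\<epsilon> = (if 0 < c' then 1 else - 1)"
    have "\<bar>c'\<bar> * \<epsilon> = c'" "\<bar>c'\<bar> * (- \<epsilon> * t) = s'" using c' by (auto simp: \<epsilon>_def t_def)
    then have neg\<epsilon>: "neg_index_ge (pencil g h \<epsilon> (- \<epsilon> * t)) W m"
      using neg_index_ge_scale[of g h "\<bar>c'\<bar>" \<epsilon> "- \<epsilon> * t" W m] cs(1) c' by simp
    define p where "p = pencil g h \<epsilon> (- \<epsilon> * t)"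
    have p: "hermitian_form p" unfolding p_def by (rule herm)
    have orth_p: "\<forall>i\<in>I. \<forall>j\<in>I. i \<noteq> j \<longrightarrow> p (v i) (v j) = 0"
      unfolding p_def by (rule orth)
    \<comment> \<open>Up to the factor \<open>\<epsilon> * (tt i - t)\<close>,
      \<open>p (v i)\<close> is \<open>h (v i)\<close>. Dividing the weights by
      \<open>tt i - t\<close> therefore makes \<open>p y\<close> a multiple of \<phi>, and
      \<open>y\<close> is \<open>p\<close>-orthogonal to \<open>W\<close>.\<close>
    define a where "a = (\<lambda>i. complex_of_real (\<omega> i / (tt i - t)))"
    define y where "y = lc K a v"
    have tK: "tt i - t \<noteq> 0" if "i \<in> K" for i using t that K(1) by (auto simp: T_def)
    have yU: "y \<in> U" unfolding y_def using lc_in_subspace[OF subU] vU K(1) by blast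
    have pyu: "p y u = of_real \<epsilon> * \<phi> u" if "u \<in> U" for u
    proof -
      obtain b where u: "u = lc I b v" using \<open>u \<in> U\<close> U(1) by blast
      have "p (v i) u = of_real (\<epsilon> * (tt i - t)) * h (v i) u" if "i \<in> K" for i
      proof -
        have i: "i \<in> I" using that K by auto
        have "p (v i) (v i) = of_real (\<epsilon> * (tt i - t)) * h (v i) (v i)"
          unfolding p_def pencil_def gii[OF i] hii by (simp add: algebra_simps)
        then show ?thesis
          unfolding u diagonal_form(1)[OF p I(1) orth_p i order.refl]
            diagonal_form(1)[OF h I(1) orth_h i order.refl] using i by simp
      qed
      then have "p y u = (\<Sum>i\<in>K. cnj (a i) * (of_real (\<epsilon> * (tt i - t)) * h (v i) u))"
        unfolding y_def hermitian_lc_left[OF p] by simp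
      also have "\<dots> = (\<Sum>i\<in>K. of_real \<epsilon> * (of_real (\<omega> i) * h (v i) u))"
      proof (intro sum.cong refl)
        fix i assume "i \<in> K"
        have "cnj (a i) * of_real (\<epsilon> * (tt i - t)) = of_real (\<omega> i / (tt i - t) * (\<epsilon> * (tt i - t)))"
          by (simp add: a_def)
        also have "\<omega> i / (tt i - t) * (\<epsilon> * (tt i - t)) = \<epsilon> * \<omega> i" using tK[OF \<open>i \<in> K\<close>] by simp
        finally show "cnj (a i) * (of_real (\<epsilon> * (tt i - t)) * h (v i) u) = of_real \<epsilon> * (of_real (\<omega> i) * h (v i) u)"
          by (simp add: mult.assoc[symmetric])
      qed
      finally show ?thesis by (simp add: \<phi>_def sum_distrib_left)
    qed
    define F where "F = 1 / (\<Prod>\<sigma>\<in>S. \<sigma> - t)"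
    have "\<phi> y = (\<Sum>i\<in>K. of_real (\<omega> i) * (a i * of_real (hi i)))"
      unfolding \<phi>_def y_def using diagonal_form(1)[OF h I(1) orth_h _ K(1)] K(1) hii
      by (intro sum.cong refl) auto
    also have "\<dots> = of_real (\<Sum>i\<in>K. C (tt i) / (tt i - t))"
      unfolding of_real_sum
    proof (intro sum.cong refl)
      fix i assume "i \<in> K"
      have "C (tt i) / (tt i - t) = \<omega> i * (\<omega> i / (tt i - t) * hi i)" using \<omega>(2)[OF \<open>i \<in> K\<close>] by simp
      then show "of_real (\<omega> i) * (a i * of_real (hi i)) = of_real (C (tt i) / (tt i - t))"
        unfolding a_def of_real_mult[symmetric] by (rule arg_cong[where f = of_real, OF sym])
    qed
    also have "(\<Sum>i\<in>K. C (tt i) / (tt i - t)) = (\<Sum>\<tau>\<in>S. C \<tau> / (\<tau> - t))"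
      using sum.reindex[OF K(2), of "\<lambda>\<tau>. C \<tau> / (\<tau> - t)"] K(3) by simp
    also have "\<dots> = (\<Sum>\<tau>\<in>S. 1 / ((\<tau> - t) * (\<Prod>\<sigma>\<in>S - {\<tau>}. \<sigma> - \<tau>)))"
      by (simp add: C_def mult.commute)
    also have "\<dots> = F"
      unfolding F_def using partial_fractions[OF fS \<open>S \<noteq> {}\<close>] t \<open>S \<subseteq> T\<close> by blast
    finally have \<phi>y: "\<phi> y = of_real F" .
    have pyy: "p y y = of_real (\<epsilon> * F)" using pyu[OF yU] \<phi>y by simp
    have tS: "t \<notin> S" using t \<open>S \<subseteq> T\<close> by blast
    have F: "F \<noteq> 0" "0 < F \<longleftrightarrow> even (card {\<sigma> \<in> S. \<sigma> < t})"
      using prod_diff_pos_iff[OF fS tS] fS tS by (auto simp: F_def)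
    have "\<epsilon> * F \<noteq> 0" using F(1) by (simp add: \<epsilon>_def)
    then consider "\<epsilon> * F < 0" | "0 < \<epsilon> * F" by (meson linorder_neqE_linordered_idom)
    then show "m < d"
    proof cases
      case 1
      \<comment> \<open>Here \<open>y\<close> is negative, so it extends each negative family in
        \<open>W\<close> to a larger one in \<open>U\<close>.\<close>
      obtain L b where L: "finite L" "card L = m" "b ` L \<subseteq> W" "neg_orthonormal p L b"
        using neg_index_geE[OF neg\<epsilon>[folded p_def] p subW] by metis
      have "p (b i) y = 0" if "i \<in> L" for i
      proof -
        have "b i \<in> U" "\<phi> (b i) = 0" using L(3) that by (auto simp: W_def)
        then have "p y (b i) = 0" using pyu by simp
        then show ?thesis using hermitian_cnj[OF p, of y "b i"] by simp
      qed
      then have "neg_index_ge p U (Suc (card L))"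
        using 1 neg_index_ge_Suc[OF p L(4,1) _ subU _ _ yU] L(3) pyy by (auto simp: W_def)
      then show ?thesis using bound L(2) unfolding p_def by fastforce
    next
      case 2
      \<comment> \<open>Here \<open>y\<close> is positive. The parity that determines the sign of
        \<open>F\<close> excludes the extreme value of \<open>N\<close> at which \<open>p\<close>
        would have index \<open>d\<close> on \<open>U\<close>.\<close>
      have "neg_index_ge p U m" using neg_index_ge_mono[OF neg\<epsilon>[folded p_def]] by (auto simp: W_def)
      then have m: "m \<le> card {i \<in> I. Re (p (v i) (v i)) < 0}" unfolding p_def by (rule index(2))
      show ?thesis
      proof (cases "0 < c'")
        case True
        then have "0 < F" using 2 by (simp add: \<epsilon>_def)
        then have "N t \<noteq> k" using F(2) S(2) by blast
        then have "card (neg t) \<noteq> d" using N_pos[OF t] pos_neg[OF t] by (auto simp: k_def)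
        then have "card (neg t) < d" using neg_le[of t] by simp
        moreover have "m \<le> card (neg t)" using m True by (simp add: neg_alt p_def \<epsilon>_def)
        ultimately show ?thesis by simp
      next
        case False
        then have "\<not> 0 < F" using 2 by (simp add: \<epsilon>_def)
        then have "N t \<noteq> int d" using F(2) S(1) by blast
        then have "card (pos t) < d" using N_pos[OF t] pos_le[of t] by simp
        moreover have "m \<le> card (pos t)" using m False by (simp add: pos_alt p_def \<epsilon>_def)
        ultimately show ?thesis by simp
      qed
    qed
  qed
  then show ?thesis using W by (intro exI[of _ W]) (auto simp: W_def)
qed

end

section \<open>Common isotropic subspaces\<close>

context complex_vector_space
begin

text \<open>If the signs were opposite, equality of the quotients would make the second pair of
  rotated values a negative multiple of the first. Undoing the rotation, at the cost of a factor
  \<open>c * c + s * s\<close>, gives the same for the original pairs, contrary to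
  \<open>z\<close>.\<close>

lemma definite_sign_transfer:
  fixes g1 h1 g2 h2 c s :: real
  assumes z: "\<not> (\<exists>r>0. g2 = - r * g1 \<and> h2 = - r * h1)"
    and nz: "c * g1 + s * h1 \<noteq> 0" "c * g2 + s * h2 \<noteq> 0"
    and eq: "(- s * g1 + c * h1) / (- c * g1 + - s * h1) = (- s * g2 + c * h2) / (- c * g2 + - s * h2)"
    and pos: "0 < - c * g1 + - s * h1"
  shows "0 < - c * g2 + - s * h2"
proof (rule ccontr)
  assume neg: "\<not> ?thesis"
  define a b where "a = - c * g1 + - s * h1" and "b = - c * g2 + - s * h2"
  have ab: "0 < a" "b < 0" using nz pos neg by (auto simp: a_def b_def)
  define r where "r = - b / a"
  have r: "0 < r" "b = - r * a" using divide_neg_pos[OF ab(2,1)] ab by (simp_all add: r_def)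
  have "- s * g2 + c * h2 = b * ((- s * g2 + c * h2) / b)" using ab by simp
  also have "\<dots> = - r * a * ((- s * g1 + c * h1) / a)"
    using eq unfolding a_def[symmetric] b_def[symmetric] r(2)[symmetric] by simp
  also have "\<dots> = - r * (- s * g1 + c * h1)" using ab by simp
  finally have "- s * g2 + c * h2 = - r * (- s * g1 + c * h1)" .
  then have 1: "s * g2 - c * h2 = - r * (s * g1 - c * h1)" by (simp add: algebra_simps)
  have 2: "c * g2 + s * h2 = - r * (c * g1 + s * h1)" using r(2) by (simp add: a_def b_def algebra_simps)
  have cs: "c * c + s * s \<noteq> 0" using nz(1) by (auto simp: sum_squares_eq_zero_iff)
  have "(c * c + s * s) * g2 = s * (s * g2 - c * h2) + c * (c * g2 + s * h2)" by (simp add: algebra_simps)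
  also have "\<dots> = (c * c + s * s) * (- r * g1)" unfolding 1 2 by (simp add: algebra_simps)
  finally have "g2 = - r * g1" using cs by (metis mult_left_cancel)
  moreover have "(c * c + s * s) * h2 = s * (c * g2 + s * h2) - c * (s * g2 - c * h2)" by (simp add: algebra_simps)
  then have "(c * c + s * s) * h2 = (c * c + s * s) * (- r * h1)" unfolding 1 2 by (simp add: algebra_simps)
  then have "h2 = - r * h1" using cs by (metis mult_left_cancel)
  ultimately show False using z r(1) by blast
qed

text \<open>A change of basis of the pencil reduces this to the normalized situation. The form
  attaining \<open>d\<close> is first made generic so that it vanishes on no diagonalizing vector,
  and absence of isotropic eigenvectors yields the sign condition.\<close>

lemma reducing_hyperplane_exists:
  assumes g: "hermitian_form g" and h: "hermitian_form h" and U: "has_dim U n" "0 < n"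
    and anis: "\<And>x. pencil_eigenvector g h U x \<Longrightarrow> g x x \<noteq> 0 \<or> h x x \<noteq> 0"
    and bound: "\<And>c s m. neg_index_ge (pencil g h c s) U m \<Longrightarrow> m \<le> d"
    and attained: "neg_index_ge (pencil g h c0 s0) U d"
  shows "\<exists>W\<subseteq>U. has_dim W (n - 1) \<and> (\<forall>c s m. neg_index_ge (pencil g h c s) W m \<longrightarrow> m < d)"
proof -
  have "\<exists>I v. finite I \<and> card I = n \<and> U = range (\<lambda>a. lc I a v) \<and>
    (\<forall>i\<in>I. \<forall>j\<in>I. i \<noteq> j \<longrightarrow> g (v i) (v j) = 0 \<and> h (v i) (v j) = 0) \<and>
    (\<forall>i\<in>I. g (v i) (v i) \<noteq> 0 \<or> h (v i) (v i) \<noteq> 0)"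
    by (rule simultaneous_diagonalization[OF g h U(1)]) (rule anis)
  then obtain I v where "finite I \<and> card I = n \<and> U = range (\<lambda>a. lc I a v) \<and>
    (\<forall>i\<in>I. \<forall>j\<in>I. i \<noteq> j \<longrightarrow> g (v i) (v j) = 0 \<and> h (v i) (v j) = 0) \<and>
    (\<forall>i\<in>I. g (v i) (v i) \<noteq> 0 \<or> h (v i) (v i) \<noteq> 0)" by (elim exE)
  then have I: "finite I" "card I = n" and Ur: "U = range (\<lambda>a. lc I a v)"
    and orth: "\<forall>i\<in>I. \<forall>j\<in>I. i \<noteq> j \<longrightarrow> g (v i) (v j) = 0" "\<forall>i\<in>I. \<forall>j\<in>I. i \<noteq> j \<longrightarrow> h (v i) (v j) = 0"
    and nz: "\<And>i. i \<in> I \<Longrightarrow> g (v i) (v i) \<noteq> 0 \<or> h (v i) (v i) \<noteq> 0" by simp_all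
  define gi hi where "gi = (\<lambda>i. Re (g (v i) (v i)))" and "hi = (\<lambda>i. Re (h (v i) (v i)))"
  have gii: "g (v i) (v i) = of_real (gi i)" and hii: "h (v i) (v i) = of_real (hi i)" for i
    unfolding gi_def hi_def using hermitian_real g h by blast+
  have nz': "(gi i, hi i) \<noteq> (0, 0)" if "i \<in> I" for i using nz[OF that] gii hii by auto
  \<comment> \<open>otherwise \<open>sqrt r v\<^sub>i + v\<^sub>j\<close> is an isotropic eigenvector\<close>
  have antipodal: "\<not> (\<exists>r>0. gi j = - r * gi i \<and> hi j = - r * hi i)" if i: "i \<in> I" and j: "j \<in> I" for i j
  proof
    assume "\<exists>r>0. gi j = - r * gi i \<and> hi j = - r * hi i"
    then obtain r where r: "r > 0" "gi j = - r * gi i" "hi j = - r * hi i" by blast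
    have "i \<noteq> j"
    proof
      assume "i = j"
      then have "(1 + r) * gi i = 0" "(1 + r) * hi i = 0" using r by (simp_all add: algebra_simps)
      then show False using nz'[OF i] r(1) by simp
    qed
    define a where "a = (\<lambda>l. if l = i then complex_of_real (sqrt r) else 1)"
    define x where "x = lc {i, j} a v"
    have ij: "{i, j} \<subseteq> I" using i j by blast
    have sq: "(cmod (a i))\<^sup>2 = r" "a j = 1" using r(1) \<open>i \<noteq> j\<close> by (auto simp: a_def)
    have zero: "f x x = 0" if f: "hermitian_form f" "\<forall>i\<in>I. \<forall>j\<in>I. i \<noteq> j \<longrightarrow> f (v i) (v j) = 0"
      and fr: "Re (f (v j) (v j)) = - r * Re (f (v i) (v i))" for f
    proof -
      have "Re (f x x) = 0"
        unfolding x_def diagonal_form(2)[OF f(1) I(1) f(2) ij] using \<open>i \<noteq> j\<close> sq fr by simp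
      then show ?thesis using hermitian_real[OF f(1), of x] by simp
    qed
    have vx: "f (v l) x = (if l \<in> {i, j} then a l * f (v l) (v l) else 0)"
      if "hermitian_form f" "\<forall>i\<in>I. \<forall>j\<in>I. i \<noteq> j \<longrightarrow> f (v i) (v j) = 0" "l \<in> I" for f l
      unfolding x_def using diagonal_form(1)[OF that(1) I(1) that(2,3) ij] .
    have "of_real (hi i) * g u x + - of_real (gi i) * h u x = 0" if "u \<in> U" for u
    proof -
      obtain b where u: "u = lc I b v" using \<open>u \<in> U\<close> Ur by blast
      have "of_real (hi i) * g (v l) x = of_real (gi i) * h (v l) x" if "l \<in> I" for l
        unfolding vx[OF g orth(1) that] vx[OF h orth(2) that] gii hii using r by auto
      then have "of_real (hi i) * g u x = of_real (gi i) * h u x"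
        unfolding u hermitian_lc_left[OF g] hermitian_lc_left[OF h] sum_distrib_left
        by (intro sum.cong refl) (simp add: mult.left_commute)
      then show ?thesis by simp
    qed
    moreover have "of_real (hi i) \<noteq> (0::complex) \<or> - of_real (gi i) \<noteq> (0::complex)" using nz'[OF i] by auto
    moreover have "x \<in> U"
    proof -
      have "v l \<in> U" if "l \<in> I" for l
        unfolding Ur using lc_single[OF I(1) that, of v] by (metis rangeI)
      then show ?thesis unfolding x_def
        by (intro lc_in_subspace[OF has_dim_subspace[OF U(1)]]) (use i j in auto)
    qed
    moreover have "x \<noteq> 0"
    proof
      assume "x = 0"
      then have "g (v j) x = 0" "h (v j) x = 0" using hermitian_zero g h by auto
      then show False using vx[OF g orth(1) j] vx[OF h orth(2) j] nz[OF j] sq by auto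
    qed
    ultimately have "pencil_eigenvector g h U x" unfolding pencil_eigenvector_def by blast
    then show False
      using anis[of x] zero[OF g orth(1)] zero[OF h orth(2)] r(2,3) by (simp add: gi_def hi_def)
  qed
  define Z where "Z = (\<lambda>i. (gi i, hi i)) ` I"
  have Z: "finite Z" "(0, 0) \<notin> Z" using I(1) nz' by (auto simp: Z_def)
  obtain c s where cs: "neg_index_ge (pencil g h c s) U d" "\<And>p q. (p, q) \<in> Z \<Longrightarrow> c * p + s * q \<noteq> 0"
    by (rule neg_index_ge_generic[OF attained g h has_dim_subspace[OF U(1)] Z]) (rule that; blast)
  have cs_nz: "c * gi i + s * hi i \<noteq> 0" if "i \<in> I" for i using cs(2) that by (auto simp: Z_def)
  have "I \<noteq> {}" using I(2) U(2) by auto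
  then obtain i0 where "i0 \<in> I" by blast
  then have cs0: "c * c + s * s \<noteq> 0" using cs_nz[of i0] by (auto simp: sum_squares_eq_zero_iff)
  \<comment> \<open>\<open>- h'\<close> is the form attaining \<open>d\<close>; \<open>g'\<close>
    completes it to a rotation of the pencil up to the factor \<open>c * c + s * s\<close> in the
    determinant, so both pairs span the same pencil.\<close>
  define g' h' where "g' = pencil g h (- s) c" and "h' = pencil g h (- c) (- s)"
  have herm: "hermitian_form g'" "hermitian_form h'" unfolding g'_def h'_def using g h hermitian_pencil by blast+
  have orth': "\<forall>i\<in>I. \<forall>j\<in>I. i \<noteq> j \<longrightarrow> g' (v i) (v j) = 0" "\<forall>i\<in>I. \<forall>j\<in>I. i \<noteq> j \<longrightarrow> h' (v i) (v j) = 0"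
    using orth by (auto simp: g'_def h'_def pencil_def)
  have gi': "Re (g' (v i) (v i)) = - s * gi i + c * hi i"
    and hi': "Re (h' (v i) (v i)) = - c * gi i + - s * hi i" for i
    by (simp_all add: g'_def h'_def pencil_def gii hii)
  have "\<exists>W\<subseteq>U. has_dim W (n - 1) \<and> (\<forall>c s m. neg_index_ge (pencil g' h' c s) W m \<longrightarrow> m < d)"
  proof (rule reducing_hyperplane[OF herm I(1) \<open>I \<noteq> {}\<close> Ur U(1) I(2) orth'])
    show "Re (h' (v i) (v i)) \<noteq> 0" if "i \<in> I" for i using cs_nz[OF that] unfolding hi' by linarith
    show "0 < Re (h' (v j) (v j))" if "i \<in> I" "j \<in> I"
      "Re (g' (v i) (v i)) / Re (h' (v i) (v i)) = Re (g' (v j) (v j)) / Re (h' (v j) (v j))"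
      "0 < Re (h' (v i) (v i))" for i j
      using definite_sign_transfer[OF antipodal[OF that(1,2)] cs_nz[OF that(1)] cs_nz[OF that(2)]] that(3,4)
      unfolding gi' hi' by blast
    show "m \<le> d" if "neg_index_ge (pencil g' h' c1 s1) U m" for c1 s1 m
      using that unfolding g'_def h'_def pencil_pencil by (rule bound)
    show "neg_index_ge (pencil g' h' 0 (- 1)) U d"
      using cs(1) unfolding g'_def h'_def pencil_pencil by simp
  qed
  then obtain W where W: "W \<subseteq> U" "has_dim W (n - 1)"
    "\<And>c s m. neg_index_ge (pencil g' h' c s) W m \<Longrightarrow> m < d" by blast
  have "m < d" if "neg_index_ge (pencil g h x y) W m" for x y m
  proof -
    define D where "D = c * c + s * s"
    have "pencil g' h' ((- s * x + c * y) / D) (- (c * x + s * y) / D) = pencil g h x y"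
    proof -
      have D: "D \<noteq> 0" using cs0 by (simp add: D_def)
      have "(- s * x + c * y) / D * - s + - (c * x + s * y) / D * - c = x * D / D"
        unfolding D_def by (simp add: add_divide_distrib[symmetric] algebra_simps diff_divide_distrib[symmetric])
      then have 1: "(- s * x + c * y) / D * - s + - (c * x + s * y) / D * - c = x" using D by simp
      have "(- s * x + c * y) / D * c + - (c * x + s * y) / D * - s = y * D / D"
        unfolding D_def by (simp add: add_divide_distrib[symmetric] algebra_simps diff_divide_distrib[symmetric])
      then have 2: "(- s * x + c * y) / D * c + - (c * x + s * y) / D * - s = y" using D by simp
      show ?thesis unfolding g'_def h'_def pencil_pencil 1 2 ..
    qed
    then show ?thesis using W(3) that by metis
  qed
  then show ?thesis using W by blast
qed

text \<open>Each reduction preserves the target \<open>n - d\<close>. Modulo an isotropic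
  eigenvector outside the radical, \<open>(n - 2) - (d - 1)\<close> plus one for the eigenvector;
  modulo one in the radical, \<open>(n - 1) - d\<close> plus one; in a reducing hyperplane,
  \<open>(n - 1) - (d - 1)\<close>. Loss of two dimensions at once calls for strong
  induction.\<close>

theorem isotropic_subspace_exists:
  assumes g: "hermitian_form g" and h: "hermitian_form h" and "has_dim U n"
    and "\<And>c s m. neg_index_ge (pencil g h c s) U m \<Longrightarrow> m \<le> d"
  shows "isotropic_dim_ge g h U (n - d)"
  using assms(3,4)
proof (induction n arbitrary: U d rule: less_induct)
  case (less n)
  note sub = has_dim_subspace[OF less.prems(1)]
  show ?case
  proof (cases "d < n")
    case False
    \<comment> \<open>Truncated subtraction makes \<open>n - d\<close> zero, and the empty family
      suffices.\<close>
    then show ?thesis unfolding isotropic_dim_ge_def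
      by (intro exI[of _ "{}"]) (auto simp: indep_def isotropic_family_def)
  next
    case True
    show ?thesis
    proof (cases "\<exists>x. pencil_eigenvector g h U x \<and> g x x = 0 \<and> h x x = 0")
      case True
      then obtain x where x: "pencil_eigenvector g h U x" "g x x = 0" "h x x = 0" by blast
      then have xU: "x \<in> U" "x \<noteq> 0" by (auto simp: pencil_eigenvector_def)
      show ?thesis
      proof (cases "\<exists>y\<in>U. g y x \<noteq> 0 \<or> h y x \<noteq> 0")
        case True
        then obtain y where y: "y \<in> U" "g y x \<noteq> 0 \<or> h y x \<noteq> 0" by blast
        obtain U' where U': "U' \<subseteq> U" "has_dim U' (n - 2)" "x \<notin> U'"
          and orth: "\<And>u. u \<in> U' \<Longrightarrow> g x u = 0 \<and> h x u = 0"
          and idx: "\<And>c s m. neg_index_ge (pencil g h c s) U' m \<Longrightarrow> \<exists>c s. neg_index_ge (pencil g h c s) U (Suc m)"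
          by (rule isotropic_eigenvector_reduction[OF g h less.prems(1) x y]) (rule that; blast)
        have idx': "Suc m \<le> d" if "neg_index_ge (pencil g h c s) U' m" for c s m
          using idx[OF that] less.prems(2) by blast
        \<comment> \<open>The empty family has index 0 on \<open>U'\<close>, which already forces
          \<open>1 \<le> d\<close>; thus \<open>d - 1\<close> is a true difference.\<close>
        then have d: "1 \<le> d" using neg_index_ge_0[of "pencil g h 0 0" U'] by fastforce
        have "isotropic_dim_ge g h U' (n - 2 - (d - 1))"
          using less.IH[OF _ U'(2), of "d - 1"] idx' \<open>d < n\<close> by fastforce
        then have "isotropic_dim_ge g h U (Suc (n - 2 - (d - 1)))"
          using isotropic_dim_ge_insert[OF g h _ U'(1) xU(1) U'(3) has_dim_subspace[OF U'(2)] x(2,3)] orth by blast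
        moreover have "Suc (n - 2 - (d - 1)) = n - d" using d \<open>d < n\<close> by linarith
        ultimately show ?thesis by simp
      next
        case False
        \<comment> \<open>Now \<open>x\<close> lies in the radical of both forms, so any complement
          of \<open>x\<close> works, with the same \<open>d\<close>.\<close>
        obtain U' where U': "U' \<subseteq> U" "has_dim U' (n - 1)" "x \<notin> U'"
          using has_dim_complement[OF less.prems(1) xU] by blast
        have orth: "g x u = 0 \<and> h x u = 0" if "u \<in> U'" for u
          using False that U'(1) hermitian_cnj[OF g, of u x] hermitian_cnj[OF h, of u x] by auto
        have "isotropic_dim_ge g h U' (n - 1 - d)"
          using less.IH[OF _ U'(2), of d] less.prems(2) neg_index_ge_mono[OF _ U'(1)] \<open>d < n\<close> by fastforce
        then have "isotropic_dim_ge g h U (Suc (n - 1 - d))"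
          using isotropic_dim_ge_insert[OF g h _ U'(1) xU(1) U'(3) has_dim_subspace[OF U'(2)] x(2,3)] orth by blast
        moreover have "Suc (n - 1 - d) = n - d" using \<open>d < n\<close> by linarith
        ultimately show ?thesis by simp
      qed
    next
      case False
      have n: "0 < n" using \<open>d < n\<close> by simp
      have "\<exists>W\<subseteq>U. has_dim W (n - 1) \<and> (\<forall>c s m. neg_index_ge (pencil g h c s) W m \<longrightarrow> m < d)"
      proof (cases "\<exists>c s. neg_index_ge (pencil g h c s) U d")
        case True
        then obtain c0 s0 where att: "neg_index_ge (pencil g h c0 s0) U d" by blast
        show ?thesis
        proof (rule reducing_hyperplane_exists[OF g h less.prems(1) n _ _ att])
          show "g x x \<noteq> 0 \<or> h x x \<noteq> 0" if "pencil_eigenvector g h U x" for x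
            using that False by blast
          show "m \<le> d" if "neg_index_ge (pencil g h c s) U m" for c s m
            using that by (rule less.prems(2))
        qed
      next
        case notatt: False
        \<comment> \<open>No form attains \<open>d\<close>, so any hyperplane will do; the
          eigenvector merely supplies a nonzero vector to drop.\<close>
        obtain x where "pencil_eigenvector g h U x"
          by (rule pencil_eigenvector_exists[OF g h less.prems(1) n])
        then have x: "x \<in> U" "x \<noteq> 0" unfolding pencil_eigenvector_def by auto
        obtain W where W: "W \<subseteq> U" "has_dim W (n - 1)"
          by (rule has_dim_complement[OF less.prems(1) x])
        have "m < d" if "neg_index_ge (pencil g h c s) W m" for c s m
          using neg_index_ge_mono[OF that W(1)] less.prems(2)[of c s m] notatt
          by (cases "m = d") auto
        then show ?thesis using W by blast
      qed
      then obtain W where W: "W \<subseteq> U" "has_dim W (n - 1)"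
        "\<And>c s m. neg_index_ge (pencil g h c s) W m \<Longrightarrow> m < d" by blast
      have d: "1 \<le> d" using W(3)[OF neg_index_ge_0[of "pencil g h 0 0" W]] by simp
      have "isotropic_dim_ge g h W (n - 1 - (d - 1))"
        using less.IH[OF _ W(2), of "d - 1"] W(3) n by fastforce
      moreover have "n - 1 - (d - 1) = n - d" using d by simp
      ultimately have "isotropic_dim_ge g h W (n - d)" by simp
      then show ?thesis using W(1) unfolding isotropic_dim_ge_def by blast
    qed
  qed
qed

end

section \<open>Conical hulls and dual cones\<close>

lemma convex_conical_hull: "convex (conical_hull S)"
  and conical_hull_scale: "x \<in> conical_hull S \<Longrightarrow> 0 \<le> r \<Longrightarrow> r *\<^sub>R x \<in> conical_hull S"
  and conical_hull_superset: "S \<subseteq> conical_hull S"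
  and conical_hull_0: "0 \<in> conical_hull S"
proof -
  have add: "x + y \<in> conical_hull S" if xy: "x \<in> conical_hull S" "y \<in> conical_hull S" for x y
  proof -
    obtain F c where F: "x = (\<Sum>x\<in>F. c x *\<^sub>R x)" "finite F" "F \<subseteq> S" "\<forall>x\<in>F. 0 \<le> c x"
      using xy(1) unfolding conical_hull_def by blast
    obtain G d where G: "y = (\<Sum>x\<in>G. d x *\<^sub>R x)" "finite G" "G \<subseteq> S" "\<forall>x\<in>G. 0 \<le> d x"
      using xy(2) unfolding conical_hull_def by blast
    define e where "e = (\<lambda>x. (if x \<in> F then c x else 0) + (if x \<in> G then d x else 0))"
    have "x = (\<Sum>x\<in>F \<union> G. (if x \<in> F then c x else 0) *\<^sub>R x)"
      unfolding F(1) using F(2) G(2) by (intro sum.mono_neutral_cong_left) auto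
    moreover have "y = (\<Sum>x\<in>F \<union> G. (if x \<in> G then d x else 0) *\<^sub>R x)"
      unfolding G(1) using F(2) G(2) by (intro sum.mono_neutral_cong_left) auto
    ultimately have "x + y = (\<Sum>x\<in>F \<union> G. e x *\<^sub>R x)"
      unfolding e_def scaleR_left_distrib sum.distrib by simp
    moreover have "\<forall>x\<in>F \<union> G. 0 \<le> e x" using F(4) G(4) by (auto simp: e_def)
    ultimately show ?thesis unfolding conical_hull_def using F G
      by (intro CollectI exI[of _ "F \<union> G"] exI[of _ e]) auto
  qed
  show scale: "r *\<^sub>R x \<in> conical_hull S" if xy: "x \<in> conical_hull S" "0 \<le> r" for x r
  proof -
    obtain F c where F: "x = (\<Sum>x\<in>F. c x *\<^sub>R x)" "finite F" "F \<subseteq> S" "\<forall>x\<in>F. 0 \<le> c x"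
      using xy(1) unfolding conical_hull_def by blast
    then have "r *\<^sub>R x = (\<Sum>x\<in>F. (r * c x) *\<^sub>R x)" by (simp add: scaleR_sum_right)
    then show ?thesis unfolding conical_hull_def using F xy(2)
      by (intro CollectI exI[of _ F] exI[of _ "\<lambda>x. r * c x"]) auto
  qed
  show "convex (conical_hull S)" unfolding convex_def using add scale by blast
  show "S \<subseteq> conical_hull S"
  proof
    fix x assume "x \<in> S"
    then show "x \<in> conical_hull S" unfolding conical_hull_def
      by (intro CollectI exI[of _ "{x}"] exI[of _ "\<lambda>_. 1"]) auto
  qed
  show "0 \<in> conical_hull S" unfolding conical_hull_def
    by (intro CollectI exI[of _ "{}"]) auto
qed

text \<open>The bipolar theorem. A hyperplane separating \<open>w\<close> from the closed hull has a
  negative level \<open>b\<close>, because 0 is in the hull. Stability under scaling then makes its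
  normal nonnegative on \<open>S\<close>.\<close>

lemma dual_cone_dual_cone:
  fixes S :: "'a::euclidean_space set"
  shows "dual_cone (dual_cone S) = closure (conical_hull S)"
proof (intro equalityI subsetI)
  fix w assume w: "w \<in> dual_cone (dual_cone S)"
  show "w \<in> closure (conical_hull S)"
  proof (rule ccontr)
    assume "w \<notin> closure (conical_hull S)"
    then obtain v b where v: "inner v w < b" "\<And>x. x \<in> closure (conical_hull S) \<Longrightarrow> b < inner v x"
      using separating_hyperplane_closed_point[OF convex_closure[OF convex_conical_hull] closed_closure]
      by blast
    have b: "b < 0" using v(2)[of 0] conical_hull_0 closure_subset by force
    have "0 \<le> inner v x" if x: "x \<in> S" for x
    proof (rule ccontr)
      assume "\<not> 0 \<le> inner v x"
      then have neg: "inner v x < 0" by simp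
      \<comment> \<open>This multiple of \<open>x\<close> reaches the level \<open>b\<close>
        exactly, contradicting strict separation.\<close>
      define r where "r = b / inner v x"
      have "0 \<le> r" using neg b by (simp add: r_def divide_nonpos_neg)
      then have "r *\<^sub>R x \<in> closure (conical_hull S)"
        using conical_hull_scale conical_hull_superset closure_subset x by blast
      then have "b < inner v (r *\<^sub>R x)" by (rule v(2))
      then show False using neg by (simp add: r_def)
    qed
    then have "v \<in> dual_cone S" unfolding dual_cone_def by blast
    then have "0 \<le> inner w v" using w unfolding dual_cone_def by blast
    then show False using v(1) b by (simp add: inner_commute)
  qed
next
  fix w assume "w \<in> closure (conical_hull S)"
  moreover have "conical_hull S \<subseteq> dual_cone (dual_cone S)"
  proof
    fix w assume "w \<in> conical_hull S"
    then obtain F c where F: "w = (\<Sum>x\<in>F. c x *\<^sub>R x)" "F \<subseteq> S" "\<forall>x\<in>F. 0 \<le> c x"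
      unfolding conical_hull_def by blast
    have "0 \<le> inner w v" if "v \<in> dual_cone S" for v
      unfolding F(1) inner_sum_left
    proof (rule sum_nonneg)
      fix x assume "x \<in> F"
      then have "0 \<le> c x" "0 \<le> inner v x" using F(2,3) that unfolding dual_cone_def by auto
      then show "0 \<le> inner (c x *\<^sub>R x) v" by (simp add: inner_commute)
    qed
    then show "w \<in> dual_cone (dual_cone S)" unfolding dual_cone_def[of "dual_cone S"] by blast
  qed
  moreover have "closed (dual_cone (dual_cone S))"
  proof -
    have "dual_cone (dual_cone S) = (\<Inter>v\<in>dual_cone S. {w. 0 \<le> inner v w})"
      unfolding dual_cone_def[of "dual_cone S"] by (auto simp: inner_commute)
    then show ?thesis by (simp add: closed_INT closed_halfspace_ge)
  qed
  ultimately show "w \<in> dual_cone (dual_cone S)" using closure_minimal by blast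
qed

lemma convex_dual_cone: "convex (dual_cone S)"
  and cone_dual_cone: "cone (dual_cone S)"
  unfolding convex_def cone_def dual_cone_def by (auto simp: inner_add_left)

section \<open>Eigenvalues of Hermitian matrices\<close>

lemma length_filter_sort: "length (filter P (sort xs)) = length (filter P xs)"
  by (rule mset_eq_length) simp

text \<open>In increasing order the \<open>k\<close>-th largest entry stands at index
  \<open>length xs - k\<close>. Smaller entries fit only into the \<open>length xs - k\<close>
  places before it, larger ones only into the \<open>k - 1\<close> places after it.\<close>

lemma order_statistic_count:
  fixes xs :: "real list"
  assumes k: "1 \<le> k" "k \<le> length xs"
  shows "\<nu> \<le> rev (sort xs) ! (k - 1) \<Longrightarrow> card {i. i < length xs \<and> xs ! i < \<nu>} \<le> length xs - k"
    and "rev (sort xs) ! (k - 1) \<le> \<nu> \<Longrightarrow> card {i. i < length xs \<and> \<nu> < xs ! i} < k"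
proof -
  define ys where "ys = sort xs"
  have ys: "sorted ys" "length ys = length xs" by (simp_all add: ys_def)
  have nth: "rev (sort xs) ! (k - 1) = ys ! (length xs - k)"
    using k by (simp add: rev_nth ys_def Suc_diff_Suc)
  have count: "card {i. i < length xs \<and> P (xs ! i)} = card {i. i < length xs \<and> P (ys ! i)}" for P
    using length_filter_sort[of P xs] unfolding length_filter_conv_card ys_def by simp
  show "card {i. i < length xs \<and> xs ! i < \<nu>} \<le> length xs - k" if "\<nu> \<le> rev (sort xs) ! (k - 1)"
  proof -
    have "{i. i < length xs \<and> ys ! i < \<nu>} \<subseteq> {..<length xs - k}"
    proof
      fix i assume i: "i \<in> {i. i < length xs \<and> ys ! i < \<nu>}"
      show "i \<in> {..<length xs - k}"
      proof (rule ccontr)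
        assume "\<not> ?thesis"
        then have "ys ! (length xs - k) \<le> ys ! i" using sorted_nth_mono[OF ys(1)] i ys(2) by auto
        then show False using that i nth by simp
      qed
    qed
    from card_mono[OF finite_lessThan this] show ?thesis using count[of "\<lambda>x. x < \<nu>"] by simp
  qed
  show "card {i. i < length xs \<and> \<nu> < xs ! i} < k" if "rev (sort xs) ! (k - 1) \<le> \<nu>"
  proof -
    have "{i. i < length xs \<and> \<nu> < ys ! i} \<subseteq> {length xs - k<..<length xs}"
    proof
      fix i assume i: "i \<in> {i. i < length xs \<and> \<nu> < ys ! i}"
      show "i \<in> {length xs - k<..<length xs}"
      proof (rule ccontr)
        assume "\<not> ?thesis"
        then have "i \<le> length xs - k" using i by auto
        then have "ys ! i \<le> ys ! (length xs - k)" using sorted_nth_mono[OF ys(1)] k ys(2) by auto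
        then show False using that i nth by simp
      qed
    qed
    then have "card {i. i < length xs \<and> \<nu> < ys ! i} \<le> card {length xs - k<..<length xs}"
      by (intro card_mono) auto
    then show ?thesis using count[of "\<lambda>x. \<nu> < x"] k by simp
  qed
qed

section \<open>Coordinate space, forms of matrices and the spectral theorem\<close>

definition cscale :: "complex \<Rightarrow> (nat \<Rightarrow> complex) \<Rightarrow> nat \<Rightarrow> complex" where
  "cscale c u = (\<lambda>i. c * u i)"

interpretation cvec: complex_vector_space cscale
  by unfold_locales (auto simp: cscale_def fun_eq_iff algebra_simps)

text \<open>
  The locale needs one type that is an abelian group and contains complex \<open>n\<close>-space for every \<open>n\<close>.
  The vectors of \<open>Jordan_Normal_Form\<close> do not form such a type, hence the functions below.
\<close>

definition coord_space :: "nat \<Rightarrow> (nat \<Rightarrow> complex) set" where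
  "coord_space n = {u. \<forall>i\<ge>n. u i = 0}"

definition sesq :: "nat \<Rightarrow> complex mat \<Rightarrow> (nat \<Rightarrow> complex) \<Rightarrow> (nat \<Rightarrow> complex) \<Rightarrow> complex" where
  "sesq n M u v = (\<Sum>i<n. \<Sum>j<n. cnj (u i) * (M $$ (i, j) * v j))"

lemma has_dim_coord_space: "cvec.has_dim (coord_space n) n"
proof -
  define e :: "nat \<Rightarrow> nat \<Rightarrow> complex" where "e = (\<lambda>j i. if i = j then 1 else 0)"
  have lc: "cvec.lc {..<n} a e i = (if i < n then a i else 0)" for a i
  proof -
    have "cvec.lc {..<n} a e i = (\<Sum>j<n. a j * e j i)"
      unfolding cvec.lc_def by (induction n) (simp_all add: cscale_def zero_fun_def plus_fun_def lessThan_Suc add.commute)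
    also have "\<dots> = (\<Sum>j<n. if j = i then a i else 0)"
      by (intro sum.cong) (auto simp: e_def)
    finally show ?thesis by simp
  qed
  have "cvec.indep {..<n} e"
    unfolding cvec.indep_def
  proof (intro allI impI ballI)
    fix a i assume "cvec.lc {..<n} a e = 0" "i \<in> {..<n}"
    then show "a i = 0" using lc[of a i] by simp
  qed
  moreover have "coord_space n = range (\<lambda>a. cvec.lc {..<n} a e)"
  proof (intro equalityI subsetI)
    fix u assume "u \<in> coord_space n"
    then have "u = cvec.lc {..<n} u e" by (intro ext) (simp add: lc coord_space_def)
    then show "u \<in> range (\<lambda>a. cvec.lc {..<n} a e)" by blast
  qed (auto simp: lc coord_space_def)
  ultimately show ?thesis unfolding cvec.has_dim_def
    by (intro exI[of _ "{..<n}"] exI[of _ e]) auto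
qed

lemma hermitian_sesq:
  assumes "\<And>i j. i < n \<Longrightarrow> j < n \<Longrightarrow> M $$ (j, i) = cnj (M $$ (i, j))"
  shows "cvec.hermitian_form (sesq n M)"
  unfolding cvec.hermitian_form_def
proof (intro conjI allI)
  fix u
  show "cvec.functional (sesq n M u)"
    unfolding cvec.functional_def sesq_def
    by (simp add: cscale_def distrib_left sum.distrib sum_distrib_left mult.left_commute)
next
  fix u v
  have "cnj (sesq n M u v) = (\<Sum>i<n. \<Sum>j<n. cnj (v j) * (M $$ (j, i) * u i))"
    unfolding sesq_def cnj_sum by (intro sum.cong refl) (simp add: assms[symmetric] mult_ac)
  then show "sesq n M v u = cnj (sesq n M u v)"
    unfolding sesq_def by (subst sum.swap) simp
qed

lemma sesq_one: "sesq n (1\<^sub>m n) u v = (\<Sum>i<n. cnj (u i) * v i)"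
proof -
  have "(\<Sum>j<n. cnj (u i) * (1\<^sub>m n $$ (i, j) * v j)) = cnj (u i) * v i" if "i < n" for i
  proof -
    have "(\<Sum>j<n. cnj (u i) * (1\<^sub>m n $$ (i, j) * v j)) = (\<Sum>j<n. if j = i then cnj (u i) * v i else 0)"
      using that by (intro sum.cong) auto
    then show ?thesis using that by simp
  qed
  then show ?thesis unfolding sesq_def by simp
qed

lemma hermitian_sesq_one: "cvec.hermitian_form (sesq n (1\<^sub>m n))"
  by (rule hermitian_sesq) auto

lemma sesq_one_pos:
  assumes "u \<in> coord_space n" "u \<noteq> 0"
  shows "0 < Re (sesq n (1\<^sub>m n) u u)"
proof -
  obtain i where i: "u i \<noteq> 0" using assms(2) by (auto simp: fun_eq_iff)
  then have "i < n" using assms(1) by (force simp: coord_space_def not_less[symmetric])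
  moreover have "Re (cnj (u i) * u i) = (cmod (u i))\<^sup>2" for i
    unfolding cmod_power2 by (simp add: power2_eq_square)
  ultimately show ?thesis using i unfolding sesq_one Re_sum
    by (simp del: times_complex.simps) (intro sum_pos2[of _ i], auto)
qed

lemma sesq_add:
  "M \<in> carrier_mat n n \<Longrightarrow> M' \<in> carrier_mat n n \<Longrightarrow> sesq n (M + M') u v = sesq n M u v + sesq n M' u v"
  unfolding sesq_def sum.distrib[symmetric] by (intro sum.cong refl) (simp add: algebra_simps)

lemma sesq_diff:
  "M \<in> carrier_mat n n \<Longrightarrow> M' \<in> carrier_mat n n \<Longrightarrow> sesq n (M - M') u v = sesq n M u v - sesq n M' u v"
  unfolding sesq_def sum_subtractf[symmetric] by (intro sum.cong refl) (simp add: algebra_simps)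

lemma sesq_smult: "M \<in> carrier_mat n n \<Longrightarrow> sesq n (c \<cdot>\<^sub>m M) u v = c * sesq n M u v"
  unfolding sesq_def sum_distrib_left by (intro sum.cong refl) (simp add: algebra_simps)

lemma mat_adjoint_carrier: "A \<in> carrier_mat n k \<Longrightarrow> mat_adjoint A \<in> carrier_mat k n"
  by (auto simp: mat_adjoint_def mat_of_rows_def)

lemma mat_adjoint_index:
  "A \<in> carrier_mat n k \<Longrightarrow> i < k \<Longrightarrow> j < n \<Longrightarrow> mat_adjoint A $$ (i, j) = cnj (A $$ (j, i))"
  by (auto simp: mat_adjoint_def mat_of_rows_def)

lemma sesq_adjoint: "A \<in> carrier_mat n n \<Longrightarrow> sesq n (mat_adjoint A) u v = cnj (sesq n A v u)"
  unfolding sesq_def cnj_sum by (subst sum.swap) (simp add: mat_adjoint_index mult_ac)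

definition col_fun :: "nat \<Rightarrow> complex mat \<Rightarrow> nat \<Rightarrow> nat \<Rightarrow> complex" where
  "col_fun n X j = (\<lambda>p. if p < n then X $$ (p, j) else 0)"

lemma mult_mat_index_sum:
  assumes "A \<in> carrier_mat n m" "B \<in> carrier_mat m k" "i < n" "j < k"
  shows "(A * B) $$ (i, j) = (\<Sum>q<m. A $$ (i, q) * B $$ (q, j))"
  using assms by (simp add: scalar_prod_def atLeast0LessThan)

text \<open>The dictionary between the matrix equations defining the rank-\<open>k\<close> numerical
  range and values of forms on the columns of \<open>X\<close>.\<close>

lemma adjoint_sandwich:
  assumes X: "X \<in> carrier_mat n k" and A: "A \<in> carrier_mat n n" and "i < k" "j < k"
  shows "(mat_adjoint X * A * X) $$ (i, j) = sesq n A (col_fun n X i) (col_fun n X j)"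
proof -
  have aX: "mat_adjoint X \<in> carrier_mat k n" using mat_adjoint_carrier[OF X] .
  have "(mat_adjoint X * A * X) $$ (i, j) = (\<Sum>q<n. (mat_adjoint X * A) $$ (i, q) * X $$ (q, j))"
    by (rule mult_mat_index_sum[OF _ X assms(3,4)]) (use A aX in simp)
  also have "\<dots> = (\<Sum>q<n. (\<Sum>p<n. cnj (X $$ (p, i)) * A $$ (p, q)) * X $$ (q, j))"
  proof (intro sum.cong refl)
    fix q assume "q \<in> {..<n}"
    then have "(mat_adjoint X * A) $$ (i, q) = (\<Sum>p<n. mat_adjoint X $$ (i, p) * A $$ (p, q))"
      by (intro mult_mat_index_sum[OF aX A assms(3)]) simp
    then show "(mat_adjoint X * A) $$ (i, q) * X $$ (q, j) =
        (\<Sum>p<n. cnj (X $$ (p, i)) * A $$ (p, q)) * X $$ (q, j)"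
      using mat_adjoint_index[OF X assms(3)] by simp
  qed
  also have "\<dots> = sesq n A (col_fun n X i) (col_fun n X j)"
    unfolding sesq_def sum_distrib_right
    by (subst sum.swap) (simp add: col_fun_def mult.assoc)
  finally show ?thesis .
qed

text \<open>The form of the identity is positive definite, so the pair of \<open>M\<close> and the
  identity has no isotropic eigenvector and is simultaneously diagonalizable. The ratios of the
  diagonal values are the eigenvalues; similarity to a diagonal matrix accounts for their
  multiplicities in the characteristic polynomial.\<close>

lemma hermitian_spectrum:
  assumes M: "M \<in> carrier_mat n n" and herm: "cvec.hermitian_form (sesq n M)"
  obtains v where "coord_space n = range (\<lambda>a. cvec.lc {..<n} a v)"
    "\<forall>i\<in>{..<n}. \<forall>j\<in>{..<n}. i \<noteq> j \<longrightarrow> sesq n M (v i) (v j) = 0"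
    "\<forall>i\<in>{..<n}. \<forall>j\<in>{..<n}. i \<noteq> j \<longrightarrow> sesq n (1\<^sub>m n) (v i) (v j) = 0"
    "\<forall>i<n. 0 < Re (sesq n (1\<^sub>m n) (v i) (v i))"
    "image_mset Re (proots (char_poly M)) =
      mset (map (\<lambda>i. Re (sesq n M (v i) (v i)) / Re (sesq n (1\<^sub>m n) (v i) (v i))) [0..<n])"
proof -
  have "\<exists>I v. finite I \<and> card I = n \<and> coord_space n = range (\<lambda>a. cvec.lc I a v) \<and>
    (\<forall>i\<in>I. \<forall>j\<in>I. i \<noteq> j \<longrightarrow> sesq n M (v i) (v j) = 0 \<and> sesq n (1\<^sub>m n) (v i) (v j) = 0) \<and>
    (\<forall>i\<in>I. sesq n M (v i) (v i) \<noteq> 0 \<or> sesq n (1\<^sub>m n) (v i) (v i) \<noteq> 0)"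
  proof (rule cvec.simultaneous_diagonalization[OF herm hermitian_sesq_one has_dim_coord_space])
    fix x assume "cvec.pencil_eigenvector (sesq n M) (sesq n (1\<^sub>m n)) (coord_space n) x"
    then have "0 < Re (sesq n (1\<^sub>m n) x x)" unfolding cvec.pencil_eigenvector_def
      using sesq_one_pos by blast
    then show "sesq n M x x \<noteq> 0 \<or> sesq n (1\<^sub>m n) x x \<noteq> 0" by auto
  qed
  then obtain I w where "finite I \<and> card I = n \<and> coord_space n = range (\<lambda>a. cvec.lc I a w) \<and>
    (\<forall>i\<in>I. \<forall>j\<in>I. i \<noteq> j \<longrightarrow> sesq n M (w i) (w j) = 0 \<and> sesq n (1\<^sub>m n) (w i) (w j) = 0) \<and>
    (\<forall>i\<in>I. sesq n M (w i) (w i) \<noteq> 0 \<or> sesq n (1\<^sub>m n) (w i) (w i) \<noteq> 0)" by (elim exE)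
  then have I: "finite I" "card I = n" and U: "coord_space n = range (\<lambda>a. cvec.lc I a w)"
    and orth: "\<And>i j. i \<in> I \<Longrightarrow> j \<in> I \<Longrightarrow> i \<noteq> j \<Longrightarrow> sesq n M (w i) (w j) = 0 \<and> sesq n (1\<^sub>m n) (w i) (w j) = 0"
    and nz: "\<And>i. i \<in> I \<Longrightarrow> sesq n M (w i) (w i) \<noteq> 0 \<or> sesq n (1\<^sub>m n) (w i) (w i) \<noteq> 0" by simp_all
  obtain f where f: "bij_betw f {..<n} I"
    using I ex_bij_betw_nat_finite[of I] by (auto simp: atLeast0LessThan)
  define v where "v = w \<circ> f"
  have fI: "f i \<in> I" if "i < n" for i using f that by (auto simp: bij_betw_def)
  have finj: "f i \<noteq> f j" if "i < n" "j < n" "i \<noteq> j" for i j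
    using f that by (auto simp: bij_betw_def inj_on_def)
  have lc: "cvec.lc I a w = cvec.lc {..<n} (a \<circ> f) v" for a
    unfolding cvec.lc_def v_def using sum.reindex_bij_betw[OF f, of "\<lambda>i. cscale (a i) (w i)"] by simp
  have vU: "v i \<in> coord_space n" if "i < n" for i
    unfolding U v_def comp_def using cvec.lc_single[OF I(1) fI[OF that], of w] by (metis rangeI)
  have U': "coord_space n = range (\<lambda>a. cvec.lc {..<n} a v)"
  proof (intro equalityI subsetI)
    fix u assume "u \<in> coord_space n"
    then show "u \<in> range (\<lambda>a. cvec.lc {..<n} a v)" unfolding U using lc by auto
  next
    fix u assume "u \<in> range (\<lambda>a. cvec.lc {..<n} a v)"
    moreover have "v ` {..<n} \<subseteq> coord_space n" using vU by auto
    ultimately show "u \<in> coord_space n"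
      using cvec.lc_in_subspace[OF cvec.has_dim_subspace[OF has_dim_coord_space]] by blast
  qed
  have o1: "sesq n M (v i) (v j) = 0" and o2: "sesq n (1\<^sub>m n) (v i) (v j) = 0"
    if "i < n" "j < n" "i \<noteq> j" for i j
    using orth[OF fI[OF that(1)] fI[OF that(2)] finj[OF that]] by (simp_all add: v_def)
  have pos: "0 < Re (sesq n (1\<^sub>m n) (v i) (v i))" if "i < n" for i
  proof -
    have "v i \<noteq> 0"
      using nz[OF fI[OF that]] cvec.hermitian_zero[OF herm] cvec.hermitian_zero[OF hermitian_sesq_one]
      by (auto simp: v_def)
    then show ?thesis using sesq_one_pos[OF vU[OF that]] by blast
  qed
  define h t where "h = (\<lambda>i. sesq n (1\<^sub>m n) (v i) (v i))" and "t = (\<lambda>i. sesq n M (v i) (v i) / h i)"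
  have hnz: "h i \<noteq> 0" if "i < n" for i using pos[OF that] by (auto simp: h_def)
  \<comment> \<open>The columns of \<open>P\<close> are orthogonal but not normalized, so its
    inverse \<open>Q\<close> is the adjoint with row \<open>i\<close> divided by
    \<open>h i\<close>.\<close>
  define P Q D where "P = mat n n (\<lambda>(r, i). v i r)" and "Q = mat n n (\<lambda>(i, r). cnj (v i r) / h i)"
    and "D = mat n n (\<lambda>(i, j). if i = j then t i else 0)"
  have carr: "P \<in> carrier_mat n n" "Q \<in> carrier_mat n n" "D \<in> carrier_mat n n"
    by (auto simp: P_def Q_def D_def)
  have QNP: "(Q * N * P) $$ (i, j) = sesq n N (v i) (v j) / h i"
    if N: "N \<in> carrier_mat n n" and ij: "i < n" "j < n" for N i j
  proof -
    have "(Q * N * P) $$ (i, j) = (\<Sum>q<n. (Q * N) $$ (i, q) * P $$ (q, j))"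
      by (rule mult_mat_index_sum[OF _ carr(1) ij]) (use N carr in simp)
    also have "\<dots> = (\<Sum>q<n. (\<Sum>p<n. cnj (v i p) / h i * N $$ (p, q)) * v j q)"
      using ij by (intro sum.cong refl) (simp add: mult_mat_index_sum[OF carr(2) N], simp add: P_def Q_def)
    also have "\<dots> = sesq n N (v i) (v j) / h i"
      unfolding sesq_def sum_distrib_right sum_divide_distrib
      by (subst sum.swap) (simp add: mult.assoc)
    finally show ?thesis .
  qed
  have "Q * P = 1\<^sub>m n"
  proof -
    have "Q * 1\<^sub>m n * P = 1\<^sub>m n"
      by (rule eq_matI) (use QNP[of "1\<^sub>m n"] o2 hnz carr in \<open>auto simp: h_def\<close>)
    then show ?thesis using carr by simp
  qed
  then have PQ: "P * Q = 1\<^sub>m n" using mat_mult_left_right_inverse carr by blast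
  have D: "Q * M * P = D"
    by (rule eq_matI) (use QNP[OF M] o1 carr in \<open>auto simp: D_def t_def\<close>)
  have "P * D * Q = (P * Q) * M * (P * Q)"
    unfolding D[symmetric] using carr M
    by (simp add: assoc_mult_mat[of _ n n _ n _ n])
  then have "M = P * D * Q" using PQ M by simp
  then have "similar_mat M D"
    by (intro similar_matI[of _ _ P Q n]) (use carr M PQ \<open>Q * P = 1\<^sub>m n\<close> in auto)
  then have "char_poly M = char_poly D" by (rule char_poly_similar)
  also have "\<dots> = (\<Prod>a\<leftarrow>diag_mat D. [:- a, 1:])"
    by (rule char_poly_upper_triangular[OF carr(3)]) (auto simp: D_def)
  also have "diag_mat D = map t [0..<n]" by (auto simp: diag_mat_def D_def)
  finally have cp: "char_poly M = (\<Prod>a\<leftarrow>map t [0..<n]. [:- a, 1:])" .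
  have roots: "proots (\<Prod>a\<leftarrow>as. [:- a, 1:]) = mset as" for as :: "complex list"
  proof (induction as)
    case (Cons a as)
    have "(\<Prod>a\<leftarrow>as. [:- a, 1:]) \<noteq> (0 :: complex poly)" by (auto simp: prod_list_zero_iff)
    then show ?case using Cons by (simp add: proots_mult del: mult_pCons_left)
  qed simp
  have Ret: "Re (t i) = Re (sesq n M (v i) (v i)) / Re (sesq n (1\<^sub>m n) (v i) (v i))" for i
    unfolding t_def h_def
    using cvec.hermitian_real[OF herm, of "v i"] cvec.hermitian_real[OF hermitian_sesq_one, of n "v i"]
    by (metis Re_complex_of_real of_real_divide)
  have "image_mset Re (proots (char_poly M)) = mset (map Re (map t [0..<n]))"
    unfolding cp roots by (simp only: mset_map)
  also have "map Re (map t [0..<n]) =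
      map (\<lambda>i. Re (sesq n M (v i) (v i)) / Re (sesq n (1\<^sub>m n) (v i) (v i))) [0..<n]"
    by (simp add: Ret)
  finally show ?thesis using that[of v] U' o1 o2 pos by auto
qed

text \<open>By inertia, the negative index of \<open>M - \<nu>\<close> counts the eigenvalues below
  \<nu>, and that of \<open>\<nu> - M\<close> those above it; the claims are then statements about
  order statistics.\<close>

lemma herm_eigval_index:
  assumes M: "M \<in> carrier_mat n n" and herm: "cvec.hermitian_form (sesq n M)" and k: "1 \<le> k" "k \<le> n"
  shows "\<nu> \<le> herm_eigval k M \<Longrightarrow>
      cvec.neg_index_ge (cvec.pencil (sesq n M) (sesq n (1\<^sub>m n)) 1 (- \<nu>)) (coord_space n) m \<Longrightarrow> m \<le> n - k"
    and "cvec.neg_index_ge (cvec.pencil (sesq n M) (sesq n (1\<^sub>m n)) (- 1) \<nu>) (coord_space n) k \<Longrightarrow>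
      \<nu> < herm_eigval k M"
proof -
  obtain v where U: "coord_space n = range (\<lambda>a. cvec.lc {..<n} a v)"
    and orth: "\<forall>i\<in>{..<n}. \<forall>j\<in>{..<n}. i \<noteq> j \<longrightarrow> sesq n M (v i) (v j) = 0"
      "\<forall>i\<in>{..<n}. \<forall>j\<in>{..<n}. i \<noteq> j \<longrightarrow> sesq n (1\<^sub>m n) (v i) (v j) = 0"
    and pos: "\<forall>i<n. 0 < Re (sesq n (1\<^sub>m n) (v i) (v i))"
    and spec: "image_mset Re (proots (char_poly M)) =
      mset (map (\<lambda>i. Re (sesq n M (v i) (v i)) / Re (sesq n (1\<^sub>m n) (v i) (v i))) [0..<n])"
    by (rule hermitian_spectrum[OF M herm])
  define h t where "h = (\<lambda>i. Re (sesq n (1\<^sub>m n) (v i) (v i)))" and "t = (\<lambda>i. Re (sesq n M (v i) (v i)) / h i)"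
  define xs where "xs = map t [0..<n]"
  have xs: "length xs = n" "\<And>i. i < n \<Longrightarrow> xs ! i = t i" by (simp_all add: xs_def)
  have "herm_eigval k M = rev (sort xs) ! (k - 1)"
    unfolding herm_eigval_def spec xs_def t_def h_def sorted_list_of_multiset_mset ..
  note count = order_statistic_count[of k xs, unfolded xs(1), OF k, folded this]
  have hpos: "0 < h i" if "i < n" for i using pos that by (simp add: h_def)
  have diag: "Re (cvec.pencil (sesq n M) (sesq n (1\<^sub>m n)) c s (v i) (v i)) = h i * (c * t i + s)"
    if "i < n" for c s i
  proof -
    have "Re (sesq n (1\<^sub>m n) (v i) (v i)) = h i" "Re (sesq n M (v i) (v i)) = t i * h i"
      using hpos[OF that] by (simp_all add: h_def t_def)
    then show ?thesis by (simp add: cvec.pencil_def algebra_simps)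
  qed
  have index: "m \<le> card {i \<in> {..<n}. Re (cvec.pencil (sesq n M) (sesq n (1\<^sub>m n)) c s (v i) (v i)) < 0}"
    if "cvec.neg_index_ge (cvec.pencil (sesq n M) (sesq n (1\<^sub>m n)) c s) (coord_space n) m" for c s m
    using cvec.neg_index_diagonal(2)[OF cvec.hermitian_pencil[OF herm hermitian_sesq_one] finite_lessThan _ U that]
      orth by (simp add: cvec.pencil_def)
  show "m \<le> n - k" if "\<nu> \<le> herm_eigval k M"
    "cvec.neg_index_ge (cvec.pencil (sesq n M) (sesq n (1\<^sub>m n)) 1 (- \<nu>)) (coord_space n) m"
  proof -
    have "{i \<in> {..<n}. Re (cvec.pencil (sesq n M) (sesq n (1\<^sub>m n)) 1 (- \<nu>) (v i) (v i)) < 0} =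
        {i. i < n \<and> xs ! i < \<nu>}"
      using diag hpos xs(2) by (auto simp: mult_less_0_iff) force+
    then show ?thesis using index[OF that(2)] count(1)[OF that(1)] by simp
  qed
  show "\<nu> < herm_eigval k M"
    if "cvec.neg_index_ge (cvec.pencil (sesq n M) (sesq n (1\<^sub>m n)) (- 1) \<nu>) (coord_space n) k"
  proof (rule ccontr)
    assume "\<not> ?thesis"
    then have "card {i. i < n \<and> \<nu> < xs ! i} < k" using count(2)[of \<nu>] by simp
    moreover have "{i \<in> {..<n}. Re (cvec.pencil (sesq n M) (sesq n (1\<^sub>m n)) (- 1) \<nu> (v i) (v i)) < 0} =
        {i. i < n \<and> \<nu> < xs ! i}"
      using diag hpos xs(2) by (auto simp: mult_less_0_iff) force+
    ultimately show False using index[OF that] by simp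
  qed
qed

section \<open>Rank-k numerical ranges\<close>

lemma rank_numerical_range_iff:
  assumes A: "A \<in> carrier_mat n n"
  shows "\<mu> \<in> rank_numerical_range k A \<longleftrightarrow> (\<exists>w. \<forall>i<k. w i \<in> coord_space n \<and>
    (\<forall>j<k. sesq n (1\<^sub>m n) (w i) (w j) = (if i = j then 1 else 0) \<and>
           sesq n A (w i) (w j) = (if i = j then \<mu> else 0)))"
    (is "?L \<longleftrightarrow> ?R")
proof
  assume ?L
  then obtain X where X: "X \<in> carrier_mat n k" "mat_adjoint X * X = 1\<^sub>m k"
    "mat_adjoint X * A * X = \<mu> \<cdot>\<^sub>m 1\<^sub>m k"
    using A unfolding rank_numerical_range_def by auto
  have "mat_adjoint X * 1\<^sub>m n * X = 1\<^sub>m k" using X(2) mat_adjoint_carrier[OF X(1)] by simp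
  then show ?R
    using X(3) unfolding coord_space_def
    by (intro exI[of _ "col_fun n X"])
      (auto simp: col_fun_def[of n X, THEN fun_cong]
        simp flip: adjoint_sandwich[OF X(1) one_carrier_mat] adjoint_sandwich[OF X(1) A])
next
  assume ?R
  then obtain w where w: "\<And>i. i < k \<Longrightarrow> w i \<in> coord_space n"
    "\<And>i j. i < k \<Longrightarrow> j < k \<Longrightarrow> sesq n (1\<^sub>m n) (w i) (w j) = (if i = j then 1 else 0)"
    "\<And>i j. i < k \<Longrightarrow> j < k \<Longrightarrow> sesq n A (w i) (w j) = (if i = j then \<mu> else 0)" by blast
  define X where "X = mat n k (\<lambda>(p, j). w j p)"
  have X: "X \<in> carrier_mat n k" by (simp add: X_def)
  have col: "col_fun n X j = w j" if "j < k" for j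
    using w(1)[OF that] that by (auto simp: col_fun_def X_def coord_space_def fun_eq_iff not_less)
  note aX = mat_adjoint_carrier[OF X]
  have "mat_adjoint X * 1\<^sub>m n * X = 1\<^sub>m k"
    by (rule eq_matI) (use adjoint_sandwich[OF X one_carrier_mat] col w(2) X aX in auto)
  then have "mat_adjoint X * X = 1\<^sub>m k" using aX by simp
  moreover have "mat_adjoint X * A * X = \<mu> \<cdot>\<^sub>m 1\<^sub>m k"
    by (rule eq_matI) (use adjoint_sandwich[OF X A] col w(3) X aX in auto)
  ultimately show ?L unfolding rank_numerical_range_def using A X by auto
qed

section \<open>The eigenvalue inequalities for a fixed matrix\<close>

context
  fixes A :: "complex mat" and n :: nat
  assumes A: "A \<in> carrier_mat n n"
begin

lemma mat_Re_Im_carrier: "mat_Re A \<in> carrier_mat n n" "mat_Im A \<in> carrier_mat n n"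
  using A mat_adjoint_carrier[OF A] by (auto simp: mat_Re_def mat_Im_def)

lemma sesq_mat_Re: "sesq n (mat_Re A) u v = (sesq n A u v + cnj (sesq n A v u)) / 2"
  unfolding mat_Re_def using A mat_adjoint_carrier[OF A]
  by (simp add: sesq_smult sesq_add sesq_adjoint)

lemma sesq_mat_Im: "sesq n (mat_Im A) u v = (sesq n A u v - cnj (sesq n A v u)) / (2 * \<i>)"
  unfolding mat_Im_def using A mat_adjoint_carrier[OF A]
  by (simp add: sesq_smult sesq_diff sesq_adjoint minus_carrier_mat)

lemma sesq_cartesian: "sesq n A u v = sesq n (mat_Re A) u v + \<i> * sesq n (mat_Im A) u v"
  unfolding sesq_mat_Re sesq_mat_Im by (simp add: field_simps)

lemma hermitian_mat_Re: "cvec.hermitian_form (sesq n (mat_Re A))"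
  by (rule hermitian_sesq) (use A mat_adjoint_carrier[OF A] in \<open>simp add: mat_Re_def mat_adjoint_index\<close>)

lemma hermitian_mat_Im: "cvec.hermitian_form (sesq n (mat_Im A))"
  by (rule hermitian_sesq)
    (use A mat_adjoint_carrier[OF A] in \<open>simp add: mat_Im_def mat_adjoint_index field_simps\<close>)

definition rotated :: "real \<Rightarrow> complex mat" where
  "rotated \<theta> = complex_of_real (cos \<theta>) \<cdot>\<^sub>m mat_Re A + complex_of_real (sin \<theta>) \<cdot>\<^sub>m mat_Im A"

lemma rotated_carrier: "rotated \<theta> \<in> carrier_mat n n"
  using mat_Re_Im_carrier by (simp add: rotated_def)

lemma sesq_rotated: "sesq n (rotated \<theta>) = cvec.pencil (sesq n (mat_Re A)) (sesq n (mat_Im A)) (cos \<theta>) (sin \<theta>)"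
  using mat_Re_Im_carrier by (auto simp: rotated_def cvec.pencil_def sesq_add sesq_smult fun_eq_iff)

lemma hermitian_rotated: "cvec.hermitian_form (sesq n (rotated \<theta>))"
  unfolding sesq_rotated by (rule cvec.hermitian_pencil[OF hermitian_mat_Re hermitian_mat_Im])

lemma eigval_angle_rotated: "eigval_angle k A \<theta> = herm_eigval k (rotated \<theta>)"
  by (simp add: eigval_angle_def rotated_def)

text \<open>On the span of the \<open>k\<close> orthonormal vectors the rotated Hermitian part is
  the scalar \<open>cos \<theta> * a + sin \<theta> * b\<close>. For \<nu> strictly below this
  scalar, \<nu> minus that part is negative definite there, so \<nu> is below the
  \<open>k\<close>-th eigenvalue; strictness is the reason for passing through
  \<open>dense_le\<close>.\<close>

lemma rank_numerical_range_le_eigval: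
  assumes k: "1 \<le> k" "k \<le> n" and ab: "Complex a b \<in> rank_numerical_range k A"
  shows "cos \<theta> * a + sin \<theta> * b \<le> eigval_angle k A \<theta>"
proof (rule dense_le)
  fix \<nu> assume \<nu>: "\<nu> < cos \<theta> * a + sin \<theta> * b"
  obtain w where w: "\<And>i. i < k \<Longrightarrow> w i \<in> coord_space n"
    "\<And>i j. i < k \<Longrightarrow> j < k \<Longrightarrow> sesq n (1\<^sub>m n) (w i) (w j) = (if i = j then 1 else 0)"
    "\<And>i j. i < k \<Longrightarrow> j < k \<Longrightarrow> sesq n A (w i) (w j) = (if i = j then Complex a b else 0)"
    using ab unfolding rank_numerical_range_iff[OF A] by blast
  define r where "r = cos \<theta> * a + sin \<theta> * b - \<nu>"
  have r: "0 < r" using \<nu> by (simp add: r_def)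
  define f where "f = cvec.pencil (sesq n (rotated \<theta>)) (sesq n (1\<^sub>m n)) (- 1) \<nu>"
  have f: "cvec.hermitian_form f"
    unfolding f_def by (rule cvec.hermitian_pencil[OF hermitian_rotated hermitian_sesq_one])
  have "sesq n (mat_Re A) (w i) (w j) = (if i = j then of_real a else 0)"
    "sesq n (mat_Im A) (w i) (w j) = (if i = j then of_real b else 0)" if "i < k" "j < k" for i j
    using that w(3) unfolding sesq_mat_Re sesq_mat_Im by (auto simp: complex_eq_iff)
  then have fw: "f (w i) (w j) = (if i = j then - of_real r else 0)" if "i < k" "j < k" for i j
    using that w(2) unfolding f_def sesq_rotated cvec.pencil_def r_def by simp
  have "cvec.neg_def_family f {..<k} w"
    unfolding cvec.neg_def_family_def
  proof (intro allI impI)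
    fix c :: "nat \<Rightarrow> complex" assume nz: "\<exists>i\<in>{..<k}. c i \<noteq> 0"
    have "\<forall>i\<in>{..<k}. \<forall>j\<in>{..<k}. i \<noteq> j \<longrightarrow> f (w i) (w j) = 0" using fw by simp
    from cvec.diagonal_form(2)[OF f finite_lessThan this order.refl]
    have "Re (f (cvec.lc {..<k} c w) (cvec.lc {..<k} c w)) = (\<Sum>i<k. (cmod (c i))\<^sup>2 * Re (f (w i) (w i)))" .
    also have "\<dots> = - (r * (\<Sum>i<k. (cmod (c i))\<^sup>2))"
      using fw by (simp add: sum_distrib_left sum_negf mult.commute)
    also have "\<dots> < 0"
    proof -
      have "0 < (\<Sum>i<k. (cmod (c i))\<^sup>2)" using nz by (auto intro: sum_pos2)
      then show ?thesis using r by simp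
    qed
    finally show "Re (f (cvec.lc {..<k} c w) (cvec.lc {..<k} c w)) < 0" .
  qed
  then have "cvec.neg_index_ge f (coord_space n) k"
    unfolding cvec.neg_index_ge_def using w(1) by (intro exI[of _ "{..<k}"] exI[of _ w]) auto
  then show "\<nu> \<le> eigval_angle k A \<theta>"
    using herm_eigval_index(2)[OF rotated_carrier hermitian_rotated k] less_imp_le
    unfolding f_def eigval_angle_rotated by blast
qed

lemma in_rank_numerical_range:
  assumes k: "1 \<le> k" "k \<le> n"
    and le: "\<And>\<theta>. 0 \<le> \<theta> \<Longrightarrow> \<theta> < 2 * pi \<Longrightarrow> cos \<theta> * a + sin \<theta> * b \<le> eigval_angle k A \<theta>"
  shows "Complex a b \<in> rank_numerical_range k A"
proof -
  define one where "one = sesq n (1\<^sub>m n)"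
  have one: "cvec.hermitian_form one" unfolding one_def by (rule hermitian_sesq_one)
  define g h where "g = cvec.pencil (sesq n (mat_Re A)) one 1 (- a)"
    and "h = cvec.pencil (sesq n (mat_Im A)) one 1 (- b)"
  have gh: "cvec.hermitian_form g" "cvec.hermitian_form h"
    unfolding g_def h_def using cvec.hermitian_pencil hermitian_mat_Re hermitian_mat_Im one by blast+
  note sub = cvec.has_dim_subspace[OF has_dim_coord_space]
  have bound: "m \<le> n - k" if neg: "cvec.neg_index_ge (cvec.pencil g h c s) (coord_space n) m" for c s m
  proof (cases "c\<^sup>2 + s\<^sup>2 = 0")
    case True
    then have cs: "c = 0" "s = 0" by (auto simp: sum_power2_eq_zero_iff)
    \<comment> \<open>The zero form of the pencil belongs to no angle; it admits only the empty
      negative family.\<close>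
    obtain I w where I: "card I = m" "cvec.neg_orthonormal (cvec.pencil g h c s) I w"
      using cvec.neg_index_geE[OF neg cvec.hermitian_pencil[OF gh] sub] by metis
    have "i \<notin> I" for i
      using I(2) unfolding cs cvec.neg_orthonormal_def cvec.pencil_def by force
    then have "I = {}" by blast
    then show ?thesis using I(1) by simp
  next
    case False
    define r where "r = sqrt (c\<^sup>2 + s\<^sup>2)"
    have "0 < c\<^sup>2 + s\<^sup>2" using False sum_power2_ge_zero[of c s] by linarith
    then have r: "0 < r" "r\<^sup>2 = c\<^sup>2 + s\<^sup>2" by (auto simp: r_def)
    have "(c / r)\<^sup>2 + (s / r)\<^sup>2 = (c\<^sup>2 + s\<^sup>2) / r\<^sup>2" by (simp add: power_divide add_divide_distrib)
    also have "\<dots> = 1" using r(1) unfolding r(2)[symmetric] by simp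
    finally obtain \<theta> where \<theta>: "0 \<le> \<theta>" "\<theta> < 2 * pi" "c / r = cos \<theta>" "s / r = sin \<theta>"
      by (rule sincos_total_2pi)
    have "c = r * cos \<theta>" "s = r * sin \<theta>" using r(1) \<theta>(3,4)[symmetric] by simp_all
    then have "cvec.neg_index_ge (cvec.pencil g h (cos \<theta>) (sin \<theta>)) (coord_space n) m"
      using neg cvec.neg_index_ge_scale[OF _ r(1)] by blast
    moreover have "cvec.pencil g h (cos \<theta>) (sin \<theta>) =
        cvec.pencil (sesq n (rotated \<theta>)) (sesq n (1\<^sub>m n)) 1 (- (cos \<theta> * a + sin \<theta> * b))"
      unfolding g_def h_def one_def sesq_rotated cvec.pencil_def
      by (intro ext) (simp add: algebra_simps)
    ultimately show ?thesis
      using herm_eigval_index(1)[OF rotated_carrier hermitian_rotated k] le[OF \<theta>(1,2)]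
      unfolding eigval_angle_rotated by metis
  qed
  have "cvec.isotropic_dim_ge g h (coord_space n) (n - (n - k))"
    by (rule cvec.isotropic_subspace_exists[OF gh has_dim_coord_space]) (rule bound)
  then obtain I w where I: "finite I" "card I = k" "w ` I \<subseteq> coord_space n" "cvec.indep I w"
    and iso: "cvec.isotropic_family g h I w"
    using k unfolding cvec.isotropic_dim_ge_def by auto
  \<comment> \<open>Minus the standard inner product: Gram-Schmidt for negative definite families
    then produces a basis of the isotropic subspace that is orthonormal in the usual sense.\<close>
  define f where "f = cvec.pencil one one (- 1) 0"
  have f: "cvec.hermitian_form f" unfolding f_def by (rule cvec.hermitian_pencil[OF one one])
  have "cvec.neg_def_family f I w"
    unfolding cvec.neg_def_family_def
  proof (intro allI impI)
    fix c :: "nat \<Rightarrow> complex" assume "\<exists>i\<in>I. c i \<noteq> 0"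
    then have "cvec.lc I c w \<noteq> 0" using I(4) unfolding cvec.indep_def by blast
    moreover have "cvec.lc I c w \<in> coord_space n" using cvec.lc_in_subspace[OF sub I(3)] .
    ultimately show "Re (f (cvec.lc I c w) (cvec.lc I c w)) < 0"
      using sesq_one_pos by (simp add: f_def cvec.pencil_def one_def)
  qed
  then obtain d where d: "cvec.neg_orthonormal f I (\<lambda>i. cvec.lc I (d i) w)"
    using cvec.Gram_Schmidt[OF f I(1)] by blast
  define x where "x = (\<lambda>i. cvec.lc I (d i) w)"
  have xx: "one (x i) (x j) = (if i = j then 1 else 0)" if "i \<in> I" "j \<in> I" for i j
    using d that unfolding cvec.neg_orthonormal_def x_def[symmetric] f_def cvec.pencil_def
    by (auto split: if_splits)
  have xg: "g (x i) (x j) = 0" "h (x i) (x j) = 0" for i j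
    using iso gh unfolding x_def cvec.isotropic_family_def
    by (simp_all add: cvec.hermitian_lc_left cvec.hermitian_lc_right)
  have xA: "sesq n A (x i) (x j) = (if i = j then Complex a b else 0)" if "i \<in> I" "j \<in> I" for i j
  proof -
    have "sesq n (mat_Re A) (x i) (x j) = of_real a * one (x i) (x j)"
      "sesq n (mat_Im A) (x i) (x j) = of_real b * one (x i) (x j)"
      using xg[of i j] by (simp_all add: g_def h_def cvec.pencil_def)
    then show ?thesis unfolding sesq_cartesian using xx[OF that] by (simp add: complex_eq_iff)
  qed
  obtain p where p: "bij_betw p {..<k} I"
    using I ex_bij_betw_nat_finite[of I] by (auto simp: atLeast0LessThan)
  have pI: "p i \<in> I" if "i < k" for i using p that by (auto simp: bij_betw_def)
  have pinj: "p i = p j \<longleftrightarrow> i = j" if "i < k" "j < k" for i j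
    using p that by (auto simp: bij_betw_def inj_on_def)
  have "x i \<in> coord_space n" for i unfolding x_def using cvec.lc_in_subspace[OF sub I(3)] .
  then show ?thesis
    unfolding rank_numerical_range_iff[OF A] using xx xA pI pinj
    by (intro exI[of _ "x \<circ> p"]) (simp add: one_def)
qed

text \<open>For \<open>c > 0\<close> the inequalities are those for the point with coordinates
  \<open>a / c\<close> and \<open>b / c\<close>. For \<open>c = 0\<close>, opposite angles on both
  axes force \<open>a = b = 0\<close>, in agreement with the convention for an empty numerical
  range.\<close>

lemma numerical_range_cone_eq:
  assumes k: "1 \<le> k" "k \<le> n"
  shows "numerical_range_cone k A =
    {(c, a, b). 0 \<le> c \<and> (\<forall>\<theta>\<in>{0..<2 * pi}. cos \<theta> * a + sin \<theta> * b \<le> eigval_angle k A \<theta> * c)}"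
    (is "_ = ?C")
proof (intro equalityI subsetI)
  fix x assume x: "x \<in> numerical_range_cone k A"
  show "x \<in> ?C"
  proof (cases "rank_numerical_range k A = {}")
    case True
    then show ?thesis using x by (simp add: numerical_range_cone_def)
  next
    case False
    then obtain l a b where l: "x = (l, l * a, l * b)" "Complex a b \<in> rank_numerical_range k A" "0 \<le> l"
      using x by (auto simp: numerical_range_cone_def)
    have "cos \<theta> * (l * a) + sin \<theta> * (l * b) \<le> eigval_angle k A \<theta> * l" for \<theta>
      using mult_left_mono[OF rank_numerical_range_le_eigval[OF k l(2), of \<theta>] l(3)]
      by (simp add: algebra_simps)
    then show ?thesis using l by simp
  qed
next
  fix x assume "x \<in> ?C"
  then obtain c a b where x: "x = (c, a, b)" and c: "0 \<le> c"
    and le: "\<And>\<theta>. 0 \<le> \<theta> \<Longrightarrow> \<theta> < 2 * pi \<Longrightarrow> cos \<theta> * a + sin \<theta> * b \<le> eigval_angle k A \<theta> * c"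
    by auto
  show "x \<in> numerical_range_cone k A"
  proof (cases "c = 0")
    case True
    have "a = 0" using le[of 0] le[of pi] True by simp
    moreover have "b = 0"
      using le[of "pi / 2"] le[of "3 / 2 * pi", unfolded cos_3over2_pi sin_3over2_pi] True by simp
    ultimately show ?thesis
    proof (cases "rank_numerical_range k A = {}")
      case False
      then obtain a' b' where "Complex a' b' \<in> rank_numerical_range k A"
        by (metis complex.collapse ex_in_conv)
      then have "(0, 0 * a', 0 * b') \<in> numerical_range_cone k A"
        using False unfolding numerical_range_cone_def by auto
      then show ?thesis using x True \<open>a = 0\<close> \<open>b = 0\<close> by simp
    qed (simp add: numerical_range_cone_def x True)
  next
    case False
    then have c: "0 < c" using c by simp
    have "cos \<theta> * (a / c) + sin \<theta> * (b / c) \<le> eigval_angle k A \<theta>" if "0 \<le> \<theta>" "\<theta> < 2 * pi" for \<theta>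
      using le[OF that] c by (simp add: add_divide_distrib[symmetric] pos_divide_le_eq)
    then have "Complex (a / c) (b / c) \<in> rank_numerical_range k A"
      by (rule in_rank_numerical_range[OF k])
    moreover have "x = (c, c * (a / c), c * (b / c))" using c by (simp add: x)
    ultimately show ?thesis using c unfolding numerical_range_cone_def by auto
  qed
qed

end

theorem theorem3p1:
  fixes A :: "complex mat" and n k :: nat
  assumes "A \<in> carrier_mat n n" and "1 \<le> k" and "k \<le> n"
  shows "convex (numerical_range_cone k A) \<and> cone (numerical_range_cone k A)
    \<and> numerical_range_cone k A =
        {(c, a, b). 0 \<le> c \<and>
           (\<forall>\<theta>\<in>{0..<2 * pi}. cos \<theta> * a + sin \<theta> * b \<le> eigval_angle k A \<theta> * c)}
    \<and> dual_cone (numerical_range_cone k A) =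
        closure (conical_hull ({(1, 0, 0)} \<union> eigval_curve k A))"
proof -
  note eq = numerical_range_cone_eq[OF assms]
  \<comment> \<open>Pairing with \<open>(1, 0, 0)\<close> gives \<open>0 \<le> c\<close>, and
    pairing with the curve point at \<theta> gives the inequality at \<theta>. The cone is thus
    itself a dual cone, and its dual is a bidual.\<close>
  have dual: "numerical_range_cone k A = dual_cone ({(1, 0, 0)} \<union> eigval_curve k A)"
  proof -
    have "eigval_curve k A = (\<lambda>\<theta>. (eigval_angle k A \<theta>, - cos \<theta>, - sin \<theta>)) ` {0..<2 * pi}"
      by (auto simp: eigval_curve_def)
    then show ?thesis
      unfolding eq dual_cone_def
      by (auto simp: inner_prod_def mult.commute[of _ "eigval_angle k A _"]
          mult.commute[of _ "cos _"] mult.commute[of _ "sin _"])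
  qed
  show ?thesis
  proof (intro conjI)
    show "convex (numerical_range_cone k A)" unfolding dual by (rule convex_dual_cone)
    show "cone (numerical_range_cone k A)" unfolding dual by (rule cone_dual_cone)
    show "dual_cone (numerical_range_cone k A) =
        closure (conical_hull ({(1, 0, 0)} \<union> eigval_curve k A))"
      unfolding dual by (rule dual_cone_dual_cone)
  qed (rule eq)
qed

end
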